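(* Let $1<\beta<2$. The following are equivalent: (1) $\beta\in(1,2)\setminus\overline{\mathcal U}$; (2) $\widetilde U_\beta$ is a subshift; (3) $\widetilde U_\beta$ is a subshift of finite type; (4) $\widetilde U_\beta$ is a closed subset of $\{0,1\}^{\mathbb{N}}$; (5) $\widetilde U_\beta$ is a sofic shift. In particular, $\widetilde U_\beta$ is never a strictly sofic shift.
   Context: $\widetilde U_\beta\subseteq\{0,1\}^{\mathbb{N}}$ is the set of sequences $(a_n)$ that are the unique $\beta$-expansion of $\sum a_n\beta^{-n}$ (i.e. no other $(b_n)\in\{0,1\}^{\mathbb{N}}$ has the same value). $\mathcal U$ is the set of $\beta\in(1,2)$ for which $1$ has a unique $\beta$-expansion, and $\overline{\mathcal U}$ its closure. $\{0,1\}^{\mathbb{N}}$ carries the product topology and the left shift $\sigma$. A subshift is a set of all sequences avoiding some collection of forbidden finite words; a subshift of finite type is one for which the collection can be taken finite. A sofic shift is a subshift $Y$ for which there exist a subshift of finite type $\Sigma$ and a continuous surjection $\phi:\Sigma\to Y$ with $\sigma\circ\phi=\phi\circ\sigma$; it is strictly sofic if it is sofic but not of finite type. *)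

theory Defs
  imports "HOL-Analysis.Analysis"
begin

text \<open>Sequences are indexed from 0 and take values in a finite alphabet of naturals.
  A binary sequence x corresponds to (a_1,a_2,...) with a_(n+1) = x n.\<close>

definition seqs :: "nat set \<Rightarrow> (nat \<Rightarrow> nat) set" where
  "seqs A = {x. \<forall>n. x n \<in> A}"

definition seq_topology :: "(nat \<Rightarrow> nat) topology" where
  "seq_topology = product_topology (\<lambda>_. discrete_topology UNIV) UNIV"

definition shift :: "(nat \<Rightarrow> nat) \<Rightarrow> (nat \<Rightarrow> nat)" where
  "shift x = (\<lambda>n. x (Suc n))"

definition occurs :: "nat list \<Rightarrow> (nat \<Rightarrow> nat) \<Rightarrow> bool" where
  "occurs w x \<longleftrightarrow> (\<exists>k. \<forall>i<length w. x (k + i) = w ! i)"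

definition avoiding :: "nat set \<Rightarrow> nat list set \<Rightarrow> (nat \<Rightarrow> nat) set" where
  "avoiding A F = {x \<in> seqs A. \<forall>w\<in>F. \<not> occurs w x}"

definition subshift :: "nat set \<Rightarrow> (nat \<Rightarrow> nat) set \<Rightarrow> bool" where
  "subshift A Y \<longleftrightarrow> (\<exists>F. Y = avoiding A F)"

definition sft :: "nat set \<Rightarrow> (nat \<Rightarrow> nat) set \<Rightarrow> bool" where
  "sft A Y \<longleftrightarrow> (\<exists>F. finite F \<and> Y = avoiding A F)"

definition sofic :: "nat set \<Rightarrow> (nat \<Rightarrow> nat) set \<Rightarrow> bool" where
  "sofic A Y \<longleftrightarrow> subshift A Y \<and>
     (\<exists>(m::nat) S \<phi>. sft {..<m} S \<and>
        continuous_map (subtopology seq_topology S) (subtopology seq_topology Y) \<phi> \<and>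
        \<phi> ` S = Y \<and> (\<forall>x\<in>S. \<phi> (shift x) = shift (\<phi> x)))"

definition strictly_sofic :: "nat set \<Rightarrow> (nat \<Rightarrow> nat) set \<Rightarrow> bool" where
  "strictly_sofic A Y \<longleftrightarrow> sofic A Y \<and> \<not> sft A Y"

definition bval :: "real \<Rightarrow> (nat \<Rightarrow> nat) \<Rightarrow> real" where
  "bval \<beta> x = (\<Sum>n. real (x n) / \<beta> ^ Suc n)"

definition Utilde :: "real \<Rightarrow> (nat \<Rightarrow> nat) set" where
  "Utilde \<beta> = {x \<in> seqs {0,1}. \<forall>y \<in> seqs {0,1}. bval \<beta> y = bval \<beta> x \<longrightarrow> y = x}"

definition Ucal :: "real set" where
  "Ucal = {\<beta>. 1 < \<beta> \<and> \<beta> < 2 \<and> (\<exists>!x. x \<in> seqs {0,1} \<and> bval \<beta> x = 1)}"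

end

theory Submission
  imports Defs
begin

text \<open>
  Let \<open>a\<close> be the quasi-greedy expansion of 1 in base \<open>b\<close>. A binary sequence \<open>x\<close> lies in \<open>Utilde b\<close>
  iff every tail of \<open>x\<close> following a digit 0, and the reflection of every tail following a digit 1,
  is lexicographically smaller than \<open>a\<close>. Everything depends on whether \<open>a\<close> strictly dominates the
  reflections of all its proper tails.

  If the tail after some digit \<open>a n = 1\<close> violates this, then no \<open>x\<close> in \<open>Utilde b\<close> can follow \<open>a\<close>
  for \<open>n + 1\<close> digits after a 0, so membership is decided by words of length \<open>n + 2\<close>: the set is
  of finite type. If there is no violation, then for infinitely many prefixes \<open>p\<close> of \<open>a\<close> the periodic
  sequence \<open>z = p (flip p) p (flip p) ...\<close> satisfies the weak inequalities and is smaller than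
  \<open>a\<close>; hence the sequences \<open>0 z\<close> lie in \<open>Utilde b\<close> and converge to \<open>0 a\<close>, which does not. Following
  a longer prefix of \<open>a\<close> by \<open>flip z\<close> gives expansions of 1 that are unique in bases
  arbitrarily close to \<open>b\<close>, so \<open>b\<close> lies in the closure of \<open>Ucal\<close>; conversely, a compactness argument
  shows that bases in this closure admit no violation.
\<close>

declare One_nat_def [simp del]

section \<open>Binary sequences and the lexicographic order\<close>

definition tail :: "nat \<Rightarrow> (nat \<Rightarrow> 'a) \<Rightarrow> nat \<Rightarrow> 'a" where
  "tail n x = (\<lambda>i. x (n + i))"

definition flip :: "(nat \<Rightarrow> nat) \<Rightarrow> nat \<Rightarrow> nat" where
  "flip x = (\<lambda>i. 1 - x i)"

text \<open>The order with its decision confined to the first \<open>n\<close> digits: a condition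
  on a finite word, so it yields forbidden words and survives a change of later digits.\<close>

definition lex_upto :: "nat \<Rightarrow> (nat \<Rightarrow> 'a::linorder) \<Rightarrow> (nat \<Rightarrow> 'a) \<Rightarrow> bool" where
  "lex_upto n x y \<longleftrightarrow> (\<exists>j<n. (\<forall>i<j. x i = y i) \<and> x j < y j)"

definition lex_less :: "(nat \<Rightarrow> 'a::linorder) \<Rightarrow> (nat \<Rightarrow> 'a) \<Rightarrow> bool" (infix "<\<^sub>l" 50) where
  "x <\<^sub>l y \<longleftrightarrow> (\<exists>j. (\<forall>i<j. x i = y i) \<and> x j < y j)"

definition lex_le :: "(nat \<Rightarrow> 'a::linorder) \<Rightarrow> (nat \<Rightarrow> 'a) \<Rightarrow> bool" (infix "\<le>\<^sub>l" 50) where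
  "x \<le>\<^sub>l y \<longleftrightarrow> x = y \<or> x <\<^sub>l y"

lemma tail_0 [simp]: "tail 0 x = x"
  by (simp add: tail_def)

lemma tail_tail [simp]: "tail m (tail n x) = tail (n + m) x"
  by (simp add: tail_def add.assoc)

lemma tail_apply: "tail n x i = x (n + i)"
  by (simp add: tail_def)

lemma flip_apply: "flip x i = 1 - x i"
  by (simp add: flip_def)

lemmas seq_apply = tail_apply flip_apply

lemma tail_flip [simp]: "tail n (flip x) = flip (tail n x)"
  by (simp add: fun_eq_iff seq_apply)

lemma seqs_cases: "x \<in> seqs {0,1} \<Longrightarrow> x n = 0 \<or> x n = 1"
  by (auto simp: seqs_def)

lemma seqs_le_1: "x \<in> seqs {0,1} \<Longrightarrow> x n \<le> 1"
  using seqs_cases[of x n] by auto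

lemma tail_in_seqs [simp, intro]: "x \<in> seqs A \<Longrightarrow> tail n x \<in> seqs A"
  by (simp add: seqs_def seq_apply)

lemma flip_in_seqs [simp, intro]: "flip x \<in> seqs {0,1}"
  by (auto simp: seqs_def seq_apply)

lemma flip_flip [simp]: "x \<in> seqs {0,1} \<Longrightarrow> flip (flip x) = x"
  using seqs_le_1 by (fastforce simp: fun_eq_iff seq_apply)

lemma lex_upto_imp_lex: "lex_upto n x y \<Longrightarrow> x <\<^sub>l y"
  by (auto simp: lex_upto_def lex_less_def)

lemma lex_upto_mono: "lex_upto n x y \<Longrightarrow> n \<le> m \<Longrightarrow> lex_upto m x y"
  unfolding lex_upto_def using order_less_le_trans by blast

lemma lex_upto_cong:
  assumes "lex_upto n x y" "\<And>i. i < n \<Longrightarrow> x' i = x i" "\<And>i. i < n \<Longrightarrow> y' i = y i"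
  shows "lex_upto n x' y'"
proof -
  obtain j where "j < n" "\<forall>i<j. x i = y i" "x j < y j"
    using assms(1) by (auto simp: lex_upto_def)
  then show ?thesis
    unfolding lex_upto_def using assms(2,3) by (intro exI[of _ j]) auto
qed

lemma lex_less_imp_upto:
  assumes "x <\<^sub>l y" "\<not> (\<forall>i<n. x i = y i)"
  shows "lex_upto n x y"
proof -
  obtain j where j: "\<forall>i<j. x i = y i" "x j < y j"
    using assms(1) by (auto simp: lex_less_def)
  moreover have "j < n"
    using assms(2) j(1) by (meson not_less order_less_le_trans)
  ultimately show ?thesis
    by (auto simp: lex_upto_def)
qed

lemma lex_irrefl [simp]: "\<not> x <\<^sub>l x"
  by (simp add: lex_less_def)

lemma lex_trans [trans]:
  assumes "x <\<^sub>l y" "y <\<^sub>l z"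
  shows "x <\<^sub>l z"
proof -
  obtain j k where j: "\<forall>i<j. x i = y i" "x j < y j" and k: "\<forall>i<k. y i = z i" "y k < z k"
    using assms by (auto simp: lex_less_def)
  show ?thesis
    unfolding lex_less_def
  proof (intro exI[of _ "min j k"] conjI allI impI)
    show "x (min j k) < z (min j k)"
      using j k by (cases j k rule: linorder_cases) (auto simp: min_def)
  qed (use j k in auto)
qed

lemma lex_total: "x <\<^sub>l y \<or> x = y \<or> y <\<^sub>l x"
proof (cases "x = y")
  case False
  then have ex: "\<exists>j. x j \<noteq> y j" by auto
  define j where "j = (LEAST j. x j \<noteq> y j)"
  have "x j \<noteq> y j" "\<forall>i<j. x i = y i"
    using LeastI_ex[OF ex] not_less_Least unfolding j_def by blast+
  then show ?thesis
    unfolding lex_less_def by (metis linorder_neqE)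
qed simp

lemma not_lex_less: "\<not> x <\<^sub>l y \<longleftrightarrow> y \<le>\<^sub>l x"
  unfolding lex_le_def using lex_total lex_trans lex_irrefl by metis

lemma lex_le_refl [simp]: "x \<le>\<^sub>l x"
  by (simp add: lex_le_def)

lemma lex_le_trans [trans]: "x \<le>\<^sub>l y \<Longrightarrow> y \<le>\<^sub>l z \<Longrightarrow> x \<le>\<^sub>l z"
  unfolding lex_le_def using lex_trans by blast

lemma lex_le_less_trans [trans]: "x \<le>\<^sub>l y \<Longrightarrow> y <\<^sub>l z \<Longrightarrow> x <\<^sub>l z"
  unfolding lex_le_def using lex_trans by blast

lemma lex_less_imp_le: "x <\<^sub>l y \<Longrightarrow> x \<le>\<^sub>l y"
  by (simp add: lex_le_def)

lemma lex_less_tail_iff: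
  assumes "\<And>i. i < n \<Longrightarrow> x i = y i"
  shows "tail n x <\<^sub>l tail n y \<longleftrightarrow> x <\<^sub>l y"
proof
  assume "tail n x <\<^sub>l tail n y"
  then obtain j where j: "\<forall>i<j. x (n + i) = y (n + i)" "x (n + j) < y (n + j)"
    by (auto simp: lex_less_def seq_apply)
  have "x i = y i" if "i < n + j" for i
    using that assms j(1) by (cases "i < n") (auto dest: spec[of _ "i - n"])
  then show "x <\<^sub>l y"
    unfolding lex_less_def using j(2) by blast
next
  assume "x <\<^sub>l y"
  then obtain j where j: "\<forall>i<j. x i = y i" "x j < y j"
    by (auto simp: lex_less_def)
  have "n \<le> j"
    using assms j(2) by (metis leI less_irrefl)
  with j show "tail n x <\<^sub>l tail n y"
    unfolding lex_less_def by (intro exI[of _ "j - n"]) (auto simp: seq_apply)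
qed

lemma lex_le_tail_iff:
  assumes "\<And>i. i < n \<Longrightarrow> x i = y i"
  shows "tail n x \<le>\<^sub>l tail n y \<longleftrightarrow> x \<le>\<^sub>l y"
  using lex_less_tail_iff[of n y x] assms by (metis not_lex_less)

lemma lex_upto_flip:
  assumes "x \<in> seqs {0,1}" "y \<in> seqs {0,1}" "lex_upto n x y"
  shows "lex_upto n (flip y) (flip x)"
proof -
  obtain j where j: "j < n" "\<forall>i<j. x i = y i" "x j < y j"
    using assms(3) by (auto simp: lex_upto_def)
  moreover have "y j \<le> 1"
    by (rule seqs_le_1[OF assms(2)])
  ultimately show ?thesis
    unfolding lex_upto_def by (intro exI[of _ j]) (auto simp: seq_apply)
qed

lemma lex_less_iff_upto: "x <\<^sub>l y \<longleftrightarrow> (\<exists>n. lex_upto n x y)"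
  unfolding lex_less_def lex_upto_def by blast

lemma lex_less_flip:
  assumes "x \<in> seqs {0,1}" "y \<in> seqs {0,1}" "x <\<^sub>l y"
  shows "flip y <\<^sub>l flip x"
  using assms lex_upto_flip unfolding lex_less_iff_upto by blast

lemma lex_less_flip_swap:
  assumes "x \<in> seqs {0,1}" "y \<in> seqs {0,1}"
  shows "flip x <\<^sub>l y \<longleftrightarrow> flip y <\<^sub>l x"
  using assms lex_less_flip[of "flip x" y] lex_less_flip[of "flip y" x] by auto

lemma lex_le_flip:
  assumes "x \<in> seqs {0,1}" "y \<in> seqs {0,1}" "x \<le>\<^sub>l y"
  shows "flip y \<le>\<^sub>l flip x"
  using assms lex_less_flip unfolding lex_le_def by blast

text \<open>Up to the first difference each digit copies its predecessor, hence equals the leading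
  1, and no digit of the tail can exceed it.\<close>

lemma lex_le_cons_1:
  assumes "x \<in> seqs {0,1}" "x 0 = 1"
  shows "tail (Suc 0) x \<le>\<^sub>l x"
proof -
  have "\<not> x <\<^sub>l tail (Suc 0) x"
  proof
    assume "x <\<^sub>l tail (Suc 0) x"
    then obtain j where j: "\<forall>i<j. x i = x (Suc i)" "x j < x (Suc j)"
      by (auto simp: lex_less_def seq_apply)
    have "i \<le> j \<Longrightarrow> x i = 1" for i
      using j(1) assms(2) by (induction i) auto
    then show False
      using j(2) seqs_le_1[OF assms(1), of "Suc j"] by fastforce
  qed
  then show ?thesis by (simp add: not_lex_less)
qed

section \<open>Values of expansions\<close>

lemma summable_bval:
  assumes "1 < b" "x \<in> seqs {0,1}"
  shows "summable (\<lambda>n. real (x n) / b ^ Suc n)"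
proof (rule summable_comparison_test)
  show "\<exists>N. \<forall>n\<ge>N. norm (real (x n) / b ^ Suc n) \<le> (1 / b) ^ n"
  proof (intro exI allI impI)
    fix n
    have "real (x n) / b ^ Suc n \<le> 1 / b ^ n"
      using seqs_le_1[OF assms(2), of n] assms(1)
      by (intro frac_le) (auto simp: mult_le_cancel_right1)
    then show "norm (real (x n) / b ^ Suc n) \<le> (1 / b) ^ n"
      using assms(1) by (simp add: power_one_over abs_mult)
  qed
  show "summable (\<lambda>n. (1 / b) ^ n)"
    using assms(1) by (intro summable_geometric) auto
qed

lemma bval_nonneg:
  assumes "1 < b" "x \<in> seqs {0,1}"
  shows "0 \<le> bval b x"
  unfolding bval_def using assms by (intro suminf_nonneg summable_bval) auto

lemma bval_pos_iff:
  assumes "1 < b" "x \<in> seqs {0,1}"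
  shows "0 < bval b x \<longleftrightarrow> (\<exists>n. x n \<noteq> 0)"
proof -
  have "0 < real (x n) / b ^ Suc n \<longleftrightarrow> x n \<noteq> 0" for n
    using assms(1) by (simp add: zero_less_divide_iff)
  then show ?thesis
    unfolding bval_def using assms by (subst suminf_pos_iff[OF summable_bval]) auto
qed

lemma bval_step:
  assumes "1 < b" "x \<in> seqs {0,1}"
  shows "bval b x = (real (x 0) + bval b (tail (Suc 0) x)) / b"
proof -
  have "bval b x = real (x 0) / b + (\<Sum>n. real (x (Suc n)) / b ^ Suc (Suc n))"
    unfolding bval_def using suminf_split_head[OF summable_bval[OF assms]] by simp
  also have "(\<Sum>n. real (x (Suc n)) / b ^ Suc (Suc n)) = (\<Sum>n. real (tail (Suc 0) x n) / b ^ Suc n / b)"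
    by (simp add: field_simps seq_apply)
  also have "\<dots> = bval b (tail (Suc 0) x) / b"
    unfolding bval_def by (rule suminf_divide) (intro summable_bval assms tail_in_seqs)
  finally show ?thesis by (simp add: add_divide_distrib)
qed

lemma bval_flip:
  assumes "1 < b" "x \<in> seqs {0,1}"
  shows "bval b (flip x) = 1 / (b - 1) - bval b x"
proof -
  have "(\<lambda>n. (1 / b) ^ n) sums (1 / (1 - 1 / b))"
    using assms(1) by (intro geometric_sums) auto
  moreover have "1 / (1 - 1 / b) / b = 1 / (b - 1)"
    using assms(1) by (simp add: divide_simps)
  ultimately have "(\<lambda>n. 1 / b ^ Suc n) sums (1 / (b - 1))"
    using sums_divide[of _ "1 / (1 - 1 / b)" b] by (fastforce simp: power_one_over mult.commute)
  from sums_diff[OF this summable_sums[OF summable_bval[OF assms]]]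
  have "(\<lambda>n. 1 / b ^ Suc n - real (x n) / b ^ Suc n) sums (1 / (b - 1) - bval b x)"
    unfolding bval_def .
  moreover have "1 / b ^ Suc n - real (x n) / b ^ Suc n = real (flip x n) / b ^ Suc n" for n
    using seqs_le_1[OF assms(2), of n] by (simp add: diff_divide_distrib of_nat_diff seq_apply)
  ultimately have "(\<lambda>n. real (flip x n) / b ^ Suc n) sums (1 / (b - 1) - bval b x)"
    by simp
  then show ?thesis
    unfolding bval_def by (simp add: sums_iff)
qed

lemma bval_le_max:
  assumes "1 < b" "x \<in> seqs {0,1}"
  shows "bval b x \<le> 1 / (b - 1)"
  using bval_flip[OF assms] bval_nonneg[OF assms(1) flip_in_seqs, of x] by simp

lemma bval_diff_tail:
  assumes "1 < b" "x \<in> seqs {0,1}" "y \<in> seqs {0,1}" "\<forall>i<n. x i = y i"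
  shows "bval b x - bval b y = (bval b (tail n x) - bval b (tail n y)) / b ^ n"
  using assms(4)
proof (induction n)
  case (Suc n)
  have "bval b (tail n x) - bval b (tail n y) =
        (bval b (tail (Suc n) x) - bval b (tail (Suc n) y)) / b"
    using bval_step[OF assms(1) tail_in_seqs[OF assms(2)], of n]
      bval_step[OF assms(1) tail_in_seqs[OF assms(3)], of n] Suc.prems
    by (simp add: diff_divide_distrib add_divide_distrib seq_apply)
  moreover have "bval b x - bval b y = (bval b (tail n x) - bval b (tail n y)) / b ^ n"
    using Suc by simp
  ultimately show ?case by (simp add: mult.commute)
qed simp

text \<open>Bridge between lexicographic order and values: the smaller sequence has the smaller
  value as soon as its remaining tail does not exceed the other one by 1 or more.\<close>

lemma bval_diff_at:
  assumes "1 < b" "x \<in> seqs {0,1}" "y \<in> seqs {0,1}" "\<forall>i<j. x i = y i" "x j < y j"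
  shows "bval b y - bval b x =
    (1 + bval b (tail (Suc j) y) - bval b (tail (Suc j) x)) / b ^ Suc j"
proof -
  have "x j = 0" "y j = 1"
    using assms(5) seqs_cases[OF assms(2), of j] seqs_cases[OF assms(3), of j] by auto
  then have "bval b (tail j y) - bval b (tail j x) =
        (1 + bval b (tail (Suc j) y) - bval b (tail (Suc j) x)) / b"
    using bval_step[OF assms(1) tail_in_seqs[OF assms(2)], of j]
      bval_step[OF assms(1) tail_in_seqs[OF assms(3)], of j]
    by (simp add: diff_divide_distrib add_divide_distrib seq_apply)
  moreover have "bval b y - bval b x = (bval b (tail j y) - bval b (tail j x)) / b ^ j"
    using assms by (intro bval_diff_tail) auto
  ultimately show ?thesis by simp
qed

text \<open>For digits produced by an expansion algorithm with remainders \<open>r\<close>: the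
  partial sums telescope, and a bounded remainder divided by \<open>b ^ n\<close> vanishes.\<close>

lemma bval_eq_of_remainders:
  assumes "1 < b" "d \<in> seqs {0,1}"
    and step: "\<And>n. r (Suc n) = b * r n - real (d n)" and bnd: "\<And>n. \<bar>r n\<bar> \<le> B"
  shows "bval b d = r 0"
proof -
  have partial: "(\<Sum>i<n. real (d i) / b ^ Suc i) = r 0 - r n / b ^ n" for n
  proof (induction n)
    case (Suc n)
    have "r (Suc n) / b ^ Suc n = r n / b ^ n - real (d n) / b ^ Suc n"
      using assms(1) by (simp add: step diff_divide_distrib)
    with Suc show ?case by simp
  qed simp
  have "(\<lambda>n. r n / b ^ n) \<longlonglongrightarrow> 0"
  proof (rule Lim_null_comparison)
    show "\<forall>\<^sub>F n in sequentially. norm (r n / b ^ n) \<le> B * (1 / b) ^ n"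
      using assms(1) bnd by (auto simp: power_one_over divide_right_mono)
    show "(\<lambda>n. B * (1 / b) ^ n) \<longlonglongrightarrow> 0"
      using assms(1) by (intro tendsto_mult_right_zero LIMSEQ_realpow_zero) auto
  qed
  then have "(\<lambda>n. r 0 - r n / b ^ n) \<longlonglongrightarrow> r 0 - 0"
    by (intro tendsto_intros)
  then have "(\<lambda>n. real (d n) / b ^ Suc n) sums r 0"
    unfolding sums_def partial by simp
  then show ?thesis unfolding bval_def by (simp add: sums_iff)
qed

lemma bval_surj:
  assumes "1 < b" "b < 2" "0 \<le> v" "v \<le> 1 / (b - 1)"
  obtains d where "d \<in> seqs {0,1}" "bval b d = v"
proof -
  \<comment> \<open>Greedy algorithm. Remainders stay in \<open>[0, 1 / (b - 1)]\<close>; when no 1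
    is subtracted this uses \<open>1 \<le> 1 / (b - 1)\<close>, that is,
    \<open>b < 2\<close>.\<close>
  define r where "r = rec_nat v (\<lambda>_ s. if 1 \<le> b * s then b * s - 1 else b * s)"
  define d where "d n = (if 1 \<le> b * r n then 1 else (0::nat))" for n
  have r0: "r 0 = v" and rS: "r (Suc n) = b * r n - real (d n)" for n
    by (simp_all add: r_def d_def)
  have bnd: "0 \<le> r n \<and> r n \<le> 1 / (b - 1)" for n
  proof (induction n)
    case (Suc n)
    have "b * r n \<le> b * (1 / (b - 1))"
      using Suc assms(1) by (intro mult_left_mono) auto
    also have "\<dots> = 1 + 1 / (b - 1)"
      using assms(1) by (simp add: field_simps)
    finally have "b * r n \<le> 1 + 1 / (b - 1)" .
    moreover have "1 \<le> 1 / (b - 1)"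
      using assms(1,2) by simp
    ultimately show ?case
      using Suc assms(1) by (cases "1 \<le> b * r n") (auto simp: rS d_def simp del: le_divide_eq_1_pos le_divide_eq_1)
  qed (use assms r0 in auto)
  have "\<bar>r n\<bar> \<le> 1 / (b - 1)" for n
    using bnd[of n] by simp
  moreover have "d \<in> seqs {0,1}"
    by (auto simp: seqs_def d_def)
  ultimately show thesis
    using bval_eq_of_remainders[of b d r, OF assms(1) _ rS] r0 that by metis
qed

section \<open>Quasi-greedy expansions of 1\<close>

text \<open>The tails are the remainders of the algorithm. Their positivity rules out an expansion
  ending in zeros, their bound 1 makes the digits as large as possible.\<close>

definition quasi_greedy :: "real \<Rightarrow> (nat \<Rightarrow> nat) \<Rightarrow> bool" where
  "quasi_greedy b a \<longleftrightarrow> a \<in> seqs {0,1} \<and> bval b a = 1 \<and>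
     (\<forall>n. 0 < bval b (tail n a) \<and> bval b (tail n a) \<le> 1)"

lemma quasi_greedy_exists:
  assumes "1 < b" "b < 2"
  obtains a where "quasi_greedy b a"
proof -
  \<comment> \<open>In contrast to the greedy algorithm the test is strict, so no remainder ever
    becomes 0.\<close>
  define r where "r = rec_nat 1 (\<lambda>_ s. if 1 < b * s then b * s - 1 else b * s)"
  define d where "d n = (if 1 < b * r n then 1 else (0::nat))" for n
  have r0: "r 0 = 1" and rS: "r (Suc n) = b * r n - real (d n)" for n
    by (simp_all add: r_def d_def)
  have bnd: "0 < r n \<and> r n \<le> 1" for n
  proof (induction n)
    case (Suc n)
    have "b * r n \<le> b * 1"
      using Suc assms(1) by (intro mult_left_mono) auto
    then have "b * r n \<le> 2"
      using assms(2) by simp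
    then show ?case
      using Suc assms by (auto simp: rS d_def)
  qed (simp add: r0)
  have d: "d \<in> seqs {0,1}"
    by (auto simp: seqs_def d_def)
  have "bval b (tail n d) = r n" for n
  proof -
    have "\<bar>tail n r i\<bar> \<le> 1" for i
      using bnd[of "n + i"] by (simp add: seq_apply)
    then have "bval b (tail n d) = tail n r 0"
    proof (intro bval_eq_of_remainders)
      show "tail n r (Suc i) = b * tail n r i - real (tail n d i)" for i
        by (simp add: rS seq_apply)
    qed (use assms(1) d in auto)
    then show ?thesis by (simp add: seq_apply)
  qed
  moreover from this[of 0] have "bval b d = 1"
    by (simp add: r0)
  ultimately have "quasi_greedy b d"
    using bnd d by (simp add: quasi_greedy_def)
  then show thesis by (rule that)
qed

lemma quasi_greedy_seqs: "quasi_greedy b a \<Longrightarrow> a \<in> seqs {0,1}"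
  by (simp add: quasi_greedy_def)

lemma quasi_greedy_hd:
  assumes "1 < b" "quasi_greedy b a"
  shows "a 0 = 1"
proof (rule ccontr)
  assume "a 0 \<noteq> 1"
  then have "a 0 = 0"
    using seqs_cases[OF quasi_greedy_seqs[OF assms(2)]] by auto
  then have "bval b (tail (Suc 0) a) = b"
    using bval_step[OF assms(1) quasi_greedy_seqs[OF assms(2)]] assms
    by (simp add: quasi_greedy_def)
  then show False
    using assms by (auto simp: quasi_greedy_def dest: spec[of _ "Suc 0"])
qed

text \<open>A larger tail would have value above 1: after the first difference its remainder is
  positive, while that of \<open>a\<close> is at most 1.\<close>

lemma quasi_greedy_tail_le:
  assumes "1 < b" "quasi_greedy b a"
  shows "tail n a \<le>\<^sub>l a"
proof -
  note a = quasi_greedy_seqs[OF assms(2)]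
  have "\<not> a <\<^sub>l tail n a"
  proof
    assume "a <\<^sub>l tail n a"
    then obtain j where j: "\<forall>i<j. a i = tail n a i" "a j < tail n a j"
      unfolding lex_less_def by blast
    have "bval b (tail n a) - bval b a =
      (1 + bval b (tail (n + Suc j) a) - bval b (tail (Suc j) a)) / b ^ Suc j"
      using bval_diff_at[OF assms(1) a tail_in_seqs[OF a] j] by (simp only: tail_tail)
    also have "bval b (tail (Suc j) a) \<le> 1" "0 < bval b (tail (n + Suc j) a)"
      using assms(2) unfolding quasi_greedy_def by blast+
    then have "(1 + bval b (tail (n + Suc j) a) - bval b (tail (Suc j) a)) / b ^ Suc j > 0"
      using assms(1) by (intro divide_pos_pos) auto
    finally show False
      using assms unfolding quasi_greedy_def by (metis diff_gt_0_iff_gt not_less)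
  qed
  then show ?thesis by (simp add: not_lex_less)
qed

text \<open>If some tail had value \<open>> 1\<close>, comparing with \<open>a\<close> at the first difference produces a
  later tail whose excess over 1 is at least \<open>b\<close> times as large, contradicting boundedness.\<close>

lemma bval_le_1_of_lex_le:
  assumes "1 < b" and a: "a \<in> seqs {0,1}" "bval b a = 1" and y: "y \<in> seqs {0,1}"
    and "y \<le>\<^sub>l a" and tails: "\<And>n. y n = 0 \<Longrightarrow> tail (Suc n) y \<le>\<^sub>l a"
  shows "bval b y \<le> 1"
proof (rule ccontr)
  assume "\<not> bval b y \<le> 1"
  define e where "e = bval b y - 1"
  have "e > 0" using \<open>\<not> bval b y \<le> 1\<close> by (simp add: e_def)
  have "\<exists>m. tail m y \<le>\<^sub>l a \<and> e * b ^ n \<le> bval b (tail m y) - 1" for n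
  proof (induction n)
    case 0
    then show ?case using \<open>y \<le>\<^sub>l a\<close> by (intro exI[of _ 0]) (simp add: e_def)
  next
    case (Suc n)
    then obtain m where m: "tail m y \<le>\<^sub>l a" "e * b ^ n \<le> bval b (tail m y) - 1" by blast
    have "0 < e * b ^ n" using \<open>e > 0\<close> assms(1) by simp
    with m(2) a have "tail m y \<noteq> a" by auto
    with m(1) obtain j where j: "\<forall>i<j. tail m y i = a i" "tail m y j < a j"
      unfolding lex_le_def lex_less_def by blast
    let ?m = "m + Suc j"
    have "y (m + j) = 0"
      using j(2) seqs_le_1[OF a(1), of j] by (simp add: seq_apply)
    then have "tail ?m y \<le>\<^sub>l a" using tails by simp
    moreover have "1 - bval b (tail m y) =
        (1 + bval b (tail (Suc j) a) - bval b (tail ?m y)) / b ^ Suc j"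
      using bval_diff_at[OF assms(1) tail_in_seqs[OF y] a(1) j] a(2) by (simp only: tail_tail)
    then have "bval b (tail ?m y) - 1 =
        bval b (tail (Suc j) a) + b ^ Suc j * (bval b (tail m y) - 1)"
      using assms(1) by (simp add: field_simps)
    then have "b ^ Suc j * (bval b (tail m y) - 1) \<le> bval b (tail ?m y) - 1"
      using bval_nonneg[OF assms(1) tail_in_seqs[OF a(1)], of "Suc j"] by simp
    moreover have "b * (e * b ^ n) \<le> b ^ Suc j * (bval b (tail m y) - 1)"
      using m(2) assms(1) \<open>0 < e * b ^ n\<close> by (intro mult_mono) auto
    ultimately show ?case
      by (intro exI[of _ ?m]) (simp add: mult.assoc mult.left_commute)
  qed
  then have "e * b ^ n \<le> 1 / (b - 1)" for n
    using bval_le_max[OF assms(1) tail_in_seqs[OF y]] by (smt (verit, best))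
  moreover obtain n where "1 / (b - 1) / e < b ^ n"
    using real_arch_pow[OF assms(1)] by blast
  then have "1 / (b - 1) < e * b ^ n"
    using \<open>e > 0\<close> by (simp add: pos_divide_less_eq mult.commute del: divide_divide_eq_left)
  ultimately show False by (meson not_less)
qed

text \<open>At the first difference \<open>y\<close> has a 0, so the rest of \<open>y\<close> is at
  most 1 by the weak version; strictness comes from the positive tail of \<open>a\<close>.\<close>

lemma bval_less_1_of_lex_less:
  assumes "1 < b" and a: "quasi_greedy b a" and y: "y \<in> seqs {0,1}"
    and less: "y <\<^sub>l a" and tails: "\<And>n. y n = 0 \<Longrightarrow> tail (Suc n) y \<le>\<^sub>l a"
  shows "bval b y < 1"
proof -
  note aseq = quasi_greedy_seqs[OF a]
  obtain j where j: "\<forall>i<j. y i = a i" "y j < a j"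
    using less by (auto simp: lex_less_def)
  have "y j = 0"
    using j(2) seqs_le_1[OF aseq, of j] by simp
  then have "bval b (tail (Suc j) y) \<le> 1"
    using tails a y assms(1) by (intro bval_le_1_of_lex_le[of b a]) (auto simp: quasi_greedy_def seq_apply)
  moreover have "0 < bval b (tail (Suc j) a)"
    using a by (simp add: quasi_greedy_def)
  ultimately have "0 < (1 + bval b (tail (Suc j) a) - bval b (tail (Suc j) y)) / b ^ Suc j"
    using assms(1) by (intro divide_pos_pos) auto
  also have "\<dots> = bval b a - bval b y"
    using bval_diff_at[OF assms(1) y aseq j] by simp
  finally show ?thesis
    using a by (simp add: quasi_greedy_def)
qed

lemma bval_ge_1_of_lex_ge:
  assumes "1 < b" and a: "quasi_greedy b a" and y: "y \<in> seqs {0,1}" and "a \<le>\<^sub>l y"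
  shows "1 \<le> bval b y"
proof (cases "y = a")
  case False
  note aseq = quasi_greedy_seqs[OF a]
  from False obtain j where j: "\<forall>i<j. a i = y i" "a j < y j"
    using \<open>a \<le>\<^sub>l y\<close> by (auto simp: lex_le_def lex_less_def)
  have "bval b (tail (Suc j) a) \<le> 1"
    using a by (simp add: quasi_greedy_def)
  moreover have "0 \<le> bval b (tail (Suc j) y)"
    using assms(1) y by (intro bval_nonneg) auto
  ultimately have "0 \<le> (1 + bval b (tail (Suc j) y) - bval b (tail (Suc j) a)) / b ^ Suc j"
    using assms(1) by (intro divide_nonneg_nonneg) auto
  also have "\<dots> = bval b y - bval b a"
    using bval_diff_at[OF assms(1) aseq y j] by simp
  finally show ?thesis
    using a by (simp add: quasi_greedy_def)
qed (use a in \<open>simp add: quasi_greedy_def\<close>)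

lemma quasi_greedyI:
  assumes "1 < b" "a \<in> seqs {0,1}" "bval b a = 1"
    and "\<And>n. tail n a \<le>\<^sub>l a" and "\<And>n. \<exists>i. a (n + i) \<noteq> 0"
  shows "quasi_greedy b a"
  unfolding quasi_greedy_def
proof (intro conjI allI)
  fix n
  show "0 < bval b (tail n a)"
    using assms by (subst bval_pos_iff) (auto simp: seq_apply)
  show "bval b (tail n a) \<le> 1"
    using assms by (intro bval_le_1_of_lex_le[of b a]) auto
qed (use assms in auto)

section \<open>Unique expansions\<close>

lemma first_difference_cases:
  fixes x y :: "nat \<Rightarrow> 'a::linorder"
  assumes "x \<noteq> y"
  obtains j where "\<forall>i<j. x i = y i" "x j < y j" | j where "\<forall>i<j. y i = x i" "y j < x j"
  using lex_total[of x y] assms unfolding lex_less_def by blast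

text \<open>A second expansion first differing at digit \<open>n\<close> exists iff the tail value,
  lowered by 1 after a 0 or raised by 1 after a 1, is still in \<open>[0, 1 / (b - 1)]\<close>. By
  \<open>bval_flip\<close> the upper bound is a condition on the reflected tail.\<close>

lemma Utilde_iff_bval:
  assumes "1 < b" "b < 2" and x: "x \<in> seqs {0,1}"
  shows "x \<in> Utilde b \<longleftrightarrow>
    (\<forall>n. (x n = 0 \<longrightarrow> bval b (tail (Suc n) x) < 1) \<and> (x n = 1 \<longrightarrow> bval b (flip (tail (Suc n) x)) < 1))"
    (is "_ \<longleftrightarrow> ?R")
proof
  assume ?R
  have "y = x" if y: "y \<in> seqs {0,1}" "bval b y = bval b x" for y
  proof (rule ccontr)
    assume "y \<noteq> x"
    then show False
    proof (cases rule: first_difference_cases)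
      case (1 j)
      have "x j = 1"
        using 1 seqs_le_1[OF x, of j] by auto
      then have "bval b (flip (tail (Suc j) x)) < 1"
        using \<open>?R\<close> by auto
      moreover have "(1 + bval b (tail (Suc j) x) - bval b (tail (Suc j) y)) / b ^ Suc j = 0"
        using bval_diff_at[OF assms(1) y(1) x 1] y(2) by simp
      then have "1 + bval b (tail (Suc j) x) - bval b (tail (Suc j) y) = 0"
        using assms(1) by simp
      ultimately show False
        using bval_flip[OF assms(1) tail_in_seqs[OF x]]
          bval_le_max[OF assms(1) tail_in_seqs[OF y(1)]] by (smt (verit))
    next
      case (2 j)
      have "x j = 0"
        using 2 seqs_le_1[OF y(1), of j] by auto
      then have "bval b (tail (Suc j) x) < 1"
        using \<open>?R\<close> by auto
      moreover have "(1 + bval b (tail (Suc j) y) - bval b (tail (Suc j) x)) / b ^ Suc j = 0"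
        using bval_diff_at[OF assms(1) x y(1) 2] y(2) by simp
      then have "1 + bval b (tail (Suc j) y) - bval b (tail (Suc j) x) = 0"
        using assms(1) by simp
      ultimately show False
        using bval_nonneg[OF assms(1) tail_in_seqs[OF y(1)]] by (smt (verit))
    qed
  qed
  then show "x \<in> Utilde b"
    using x by (simp add: Utilde_def)
next
  assume U: "x \<in> Utilde b"
  \<comment> \<open>Both digits at once:
    \<open>real c + bval b (tail (Suc n) x) - real (1 - c)\<close> is the value left for the rest
    once digit \<open>c\<close> is replaced by \<open>1 - c\<close>.\<close>
  have *: False if c: "x n = c" "c = 0 \<or> c = 1"
      "0 \<le> real c + bval b (tail (Suc n) x) - real (1 - c)"
      "real c + bval b (tail (Suc n) x) - real (1 - c) \<le> 1 / (b - 1)" for n c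
  proof -
    obtain d where d: "d \<in> seqs {0,1}" "bval b d = real c + bval b (tail (Suc n) x) - real (1 - c)"
      using bval_surj[OF assms(1,2) c(3,4)] by blast
    define y where "y i = (if i < n then x i else if i = n then 1 - c else d (i - Suc n))" for i
    have y: "y \<in> seqs {0,1}"
      using x d(1) c(2) unfolding seqs_def y_def by auto
    have agree: "\<forall>i<n. y i = x i"
      by (simp add: y_def)
    have "bval b (tail n y) = (real (tail n y 0) + bval b (tail (Suc 0) (tail n y))) / b"
      using assms(1) y by (intro bval_step) auto
    also have "tail (Suc 0) (tail n y) = d"
      by (auto simp: y_def fun_eq_iff seq_apply)
    also have "real (tail n y 0) = real (1 - c)"
      by (simp add: y_def seq_apply)
    also have "(real (1 - c) + bval b d) / b = (real (tail n x 0) + bval b (tail (Suc 0) (tail n x))) / b"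
      using d(2) c(1) by (simp add: seq_apply)
    also have "\<dots> = bval b (tail n x)"
      using assms(1) x by (intro bval_step[symmetric]) auto
    finally have "bval b y - bval b x = 0"
      using bval_diff_tail[OF assms(1) y x agree] by simp
    then have "y = x"
      using U y by (auto simp: Utilde_def)
    then have "y n = x n" by simp
    then show False
      using c(1,2) by (auto simp: y_def)
  qed
  show ?R
  proof (intro allI conjI impI)
    fix n
    show "bval b (tail (Suc n) x) < 1" if "x n = 0"
      using *[OF that] bval_le_max[OF assms(1) tail_in_seqs[OF x], of "Suc n"] by force
    show "bval b (flip (tail (Suc n) x)) < 1" if "x n = 1"
      using *[OF that] bval_flip[OF assms(1) tail_in_seqs[OF x], of "Suc n"]
        bval_nonneg[OF assms(1) tail_in_seqs[OF x], of "Suc n"] by force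
  qed
qed

lemma Utilde_iff_lex:
  assumes "1 < b" "b < 2" and a: "quasi_greedy b a" and x: "x \<in> seqs {0,1}"
  shows "x \<in> Utilde b \<longleftrightarrow>
    (\<forall>n. (x n = 0 \<longrightarrow> tail (Suc n) x <\<^sub>l a) \<and> (x n = 1 \<longrightarrow> flip (tail (Suc n) x) <\<^sub>l a))"
    (is "_ \<longleftrightarrow> ?R")
proof
  assume "x \<in> Utilde b"
  then have *: "x n = 0 \<Longrightarrow> bval b (tail (Suc n) x) < 1"
      "x n = 1 \<Longrightarrow> bval b (flip (tail (Suc n) x)) < 1" for n
    using Utilde_iff_bval[OF assms(1,2) x] by auto
  show ?R
  proof (intro allI conjI impI)
    fix n
    show "tail (Suc n) x <\<^sub>l a" if "x n = 0"
      using *(1)[OF that] bval_ge_1_of_lex_ge[OF assms(1) a] x by (meson not_less not_lex_less tail_in_seqs)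
    show "flip (tail (Suc n) x) <\<^sub>l a" if "x n = 1"
      using *(2)[OF that] bval_ge_1_of_lex_ge[OF assms(1) a] by (meson not_less not_lex_less flip_in_seqs)
  qed
next
  assume R: ?R
  have "bval b (tail (Suc n) x) < 1" if "x n = 0" for n
    using R that x by (intro bval_less_1_of_lex_less[OF assms(1) a]) (auto intro: lex_less_imp_le simp: seq_apply)
  moreover have "bval b (flip (tail (Suc n) x)) < 1" if "x n = 1" for n
  proof (rule bval_less_1_of_lex_less[OF assms(1) a])
    fix k assume "flip (tail (Suc n) x) k = 0"
    then have "x (Suc n + k) = 1"
      using seqs_cases[OF x, of "Suc n + k"] by (auto simp: seq_apply)
    then have "flip (tail (Suc (Suc n + k)) x) <\<^sub>l a"
      using R by blast
    then show "tail (Suc k) (flip (tail (Suc n) x)) \<le>\<^sub>l a"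
      by (simp add: lex_less_imp_le)
  qed (use R that in auto)
  ultimately show "x \<in> Utilde b"
    using Utilde_iff_bval[OF assms(1,2) x] by auto
qed

section \<open>Sequences dominating all their reflected tails\<close>

text \<open>The quasi-greedy expansions with this property turn out to be those of the bases in the
  closure of \<open>Ucal\<close>.\<close>

definition reflection_dominant :: "(nat \<Rightarrow> nat) \<Rightarrow> bool" where
  "reflection_dominant a \<longleftrightarrow> a \<in> seqs {0,1} \<and> (\<forall>n. tail n a \<le>\<^sub>l a) \<and> (\<forall>n. flip (tail (Suc n) a) <\<^sub>l a)"

text \<open>Strictness in the first inequality excludes periodic sequences. In a base between 1 and
  2 such an expansion of 1 is the unique one.\<close>

definition strictly_dominant :: "(nat \<Rightarrow> nat) \<Rightarrow> bool" where
  "strictly_dominant a \<longleftrightarrow>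
     a \<in> seqs {0,1} \<and> (\<forall>n. tail (Suc n) a <\<^sub>l a \<and> flip (tail (Suc n) a) <\<^sub>l a)"

lemma reflection_dominant_hd:
  assumes "reflection_dominant a"
  shows "a 0 = 1"
proof (rule ccontr)
  assume "a 0 \<noteq> 1"
  then have "a 0 = 0"
    using assms seqs_cases unfolding reflection_dominant_def by blast
  have "a n = 0" for n
  proof (rule ccontr)
    assume "a n \<noteq> 0"
    then have "a <\<^sub>l tail n a"
      unfolding lex_less_def using \<open>a 0 = 0\<close> by (intro exI[of _ 0]) (simp add: seq_apply)
    then show False
      using assms unfolding reflection_dominant_def by (meson not_lex_less)
  qed
  moreover have "flip (tail (Suc 0) a) <\<^sub>l a"
    using assms by (simp add: reflection_dominant_def)
  ultimately show False
    by (simp add: lex_less_def)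
qed

section \<open>Good prefixes and their reflected periods\<close>

definition good_length :: "(nat \<Rightarrow> nat) \<Rightarrow> nat \<Rightarrow> bool" where
  "good_length a m \<longleftrightarrow> (\<forall>k<m. lex_upto (m - k) (flip (tail k a)) a)"

text \<open>If \<open>m\<close> is not good, take the least \<open>k\<close> such that the reflection of the tail at \<open>k\<close>
  agrees with \<open>a\<close> up to \<open>m\<close>; the length just after that agreement ends is good.\<close>

lemma good_length_unbounded:
  assumes a: "reflection_dominant a"
  obtains m' where "m \<le> m'" "0 < m'" "good_length a m'"
proof (cases "good_length a (Suc m)")
  case True
  then show thesis using that[of "Suc m"] by simp
next
  case False
  note aseq = a[unfolded reflection_dominant_def, THEN conjunct1]
  note hd = reflection_dominant_hd[OF a]
  let ?P = "\<lambda>k. k < Suc m \<and> \<not> lex_upto (Suc m - k) (flip (tail k a)) a"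
  have ex: "\<exists>k. ?P k"
    using False by (auto simp: good_length_def)
  define k0 where "k0 = (LEAST k. ?P k)"
  have k0: "k0 < Suc m" "\<not> lex_upto (Suc m - k0) (flip (tail k0 a)) a"
    using LeastI_ex[OF ex] unfolding k0_def by blast+
  have k0_min: "lex_upto (Suc m - k) (flip (tail k a)) a" if "k < k0" for k
    using not_less_Least[of k ?P] that k0(1) unfolding k0_def[symmetric] by auto
  have flip_less: "flip (tail k a) <\<^sub>l a" for k
  proof (cases k)
    case 0
    then show ?thesis
      unfolding lex_less_def using hd by (intro exI[of _ 0]) (simp add: seq_apply)
  next
    case (Suc n)
    then show ?thesis using a by (simp add: reflection_dominant_def)
  qed
  obtain j where j: "\<forall>i<j. flip (tail k0 a) i = a i" "flip (tail k0 a) j < a j"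
    using flip_less[of k0] unfolding lex_less_def by blast
  have j_ge: "Suc m - k0 \<le> j"
    using k0(2) j unfolding lex_upto_def by (meson not_less)
  have aj: "a (k0 + j) = 1" "a j = 1"
    using j(2) seqs_cases[OF aseq, of j] seqs_cases[OF aseq, of "k0 + j"]
    by (auto simp: seq_apply)
  let ?m = "Suc (k0 + j)"
  have "lex_upto (?m - k) (flip (tail k a)) a" if k: "k < ?m" for k
  proof (cases k k0 rule: linorder_cases)
    case less
    then show ?thesis
      using lex_upto_mono[OF k0_min[OF less]] j_ge by simp
  next
    case equal
    then show ?thesis
      unfolding lex_upto_def using j by (intro exI[of _ j]) auto
  next
    case greater
    then obtain d where d: "k = k0 + d" "0 < d"
      using less_imp_add_positive by blast
    have dj: "d \<le> j" using k d by simp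
    show ?thesis
    proof (rule ccontr)
      assume "\<not> ?thesis"
      then have agree: "1 - a (k + i) = a i" if "i < ?m - k" for i
        using lex_less_imp_upto[OF flip_less] that by (fastforce simp: seq_apply)
      \<comment> \<open>Combining the agreements at \<open>k0\<close> and at \<open>k\<close>
        reflects twice: \<open>a\<close> agrees with its own tail at \<open>d\<close> up to
        \<open>j - d\<close>, where \<open>a\<close> has 0 and the tail has 1.\<close>
      have "a <\<^sub>l tail d a"
        unfolding lex_less_def
      proof (intro exI conjI allI impI)
        fix i assume "i < j - d"
        then show "a i = tail d a i"
          using agree[of i] j(1)[rule_format, of "d + i"] d by (simp add: seq_apply ac_simps)
      next
        show "a (j - d) < tail d a (j - d)"
          using agree[of "j - d"] d dj aj by (simp add: seq_apply)
      qed
      then show False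
        using a not_lex_less unfolding reflection_dominant_def by blast
    qed
  qed
  then have "good_length a ?m"
    by (simp add: good_length_def)
  then show thesis
    using that[of ?m] j_ge k0(1) by simp
qed

text \<open>The periodic sequence with period block \<open>p (flip p)\<close>, where \<open>p\<close> is the prefix of \<open>a\<close> of
  length \<open>m\<close>.\<close>

definition reflected_period :: "(nat \<Rightarrow> nat) \<Rightarrow> nat \<Rightarrow> nat \<Rightarrow> nat" where
  "reflected_period a m i = (if even (i div m) then a (i mod m) else 1 - a (i mod m))"

lemma reflected_period_prefix: "i < m \<Longrightarrow> reflected_period a m i = a i"
  by (simp add: reflected_period_def)

lemma reflected_period_in_seqs [intro]:
  "a \<in> seqs {0,1} \<Longrightarrow> reflected_period a m \<in> seqs {0,1}"
  by (auto simp: reflected_period_def seqs_def)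

lemma tail_reflected_period:
  assumes "a \<in> seqs {0,1}" "0 < m"
  shows "tail m (reflected_period a m) = flip (reflected_period a m)"
proof
  fix i
  show "tail m (reflected_period a m) i = flip (reflected_period a m) i"
    using assms(2) seqs_le_1[OF assms(1), of "i mod m"]
    by (auto simp: seq_apply reflected_period_def)
qed

text \<open>A tail of \<open>w\<close> starting inside the prefix and agreeing with \<open>a\<close> up to the end of that prefix
  is compared with \<open>w\<close> through the following \<open>m\<close> digits, which are reflected digits of \<open>a\<close>.\<close>

lemma prefix_tails_dominated:
  assumes a: "reflection_dominant a" and w: "w \<in> seqs {0,1}"
    and prefix: "\<And>i. i < M \<Longrightarrow> w i = a i" and reflected: "\<And>i. i < m \<Longrightarrow> w (M + i) = 1 - a i"
    and bound: "\<And>j. 0 < j \<Longrightarrow> j < M \<Longrightarrow> lex_upto (min m (M - j)) (flip (tail j a)) a"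
    and k: "0 < k" "k < M"
  shows "tail k w <\<^sub>l w" "flip (tail k w) <\<^sub>l w"
proof -
  note aseq = a[unfolded reflection_dominant_def, THEN conjunct1]
  have "lex_upto (M - k) (flip (tail k a)) a"
    using lex_upto_mono[OF bound[OF k]] by simp
  then have "lex_upto (M - k) (flip (tail k w)) w"
    by (rule lex_upto_cong) (auto simp: seq_apply prefix)
  then show "flip (tail k w) <\<^sub>l w"
    by (rule lex_upto_imp_lex)
  show "tail k w <\<^sub>l w"
  proof (cases "\<forall>i<M - k. tail k a i = a i")
    case True
    let ?j = "M - k"
    have "lex_upto (min m (M - ?j)) (flip (tail ?j a)) a"
      using k by (intro bound) auto
    from lex_upto_flip[OF flip_in_seqs aseq this]
    have "lex_upto (min m k) (flip a) (tail ?j a)"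
      using aseq k by simp
    then have "lex_upto (min m k) (tail M w) (tail ?j w)"
      using k by (elim lex_upto_cong) (auto simp: seq_apply reflected prefix)
    then have "tail ?j (tail k w) <\<^sub>l tail ?j w"
      using k by (simp add: lex_upto_imp_lex)
    then show ?thesis
      using True k by (subst (asm) lex_less_tail_iff) (auto simp: seq_apply prefix)
  next
    case False
    then have "tail k a \<noteq> a" by auto
    then have "tail k a <\<^sub>l a"
      using a unfolding reflection_dominant_def lex_le_def by blast
    then have "lex_upto (M - k) (tail k a) a"
      using False by (rule lex_less_imp_upto)
    then have "lex_upto (M - k) (tail k w) w"
      by (rule lex_upto_cong) (auto simp: seq_apply prefix)
    then show ?thesis
      by (rule lex_upto_imp_lex)
  qed
qed

context
  fixes a m
  assumes a: "reflection_dominant a" and m: "0 < m" "good_length a m"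
begin

private lemma aseq: "a \<in> seqs {0,1}"
  using a by (simp add: reflection_dominant_def)

text \<open>Inside the first block the strict prefix lemma applies with \<open>M = m\<close>. Beyond
  it, dropping a block reflects the sequence, which swaps the two inequalities.\<close>

lemma reflected_period_tails_le:
  "tail k (reflected_period a m) \<le>\<^sub>l reflected_period a m \<and>
   flip (tail k (reflected_period a m)) \<le>\<^sub>l reflected_period a m" (is "tail k ?z \<le>\<^sub>l _ \<and> _")
proof (induction k rule: less_induct)
  case (less k)
  have z: "?z \<in> seqs {0,1}"
    using aseq by auto
  consider "k = 0" | "0 < k" "k < m" | "m \<le> k" by linarith
  then show ?case
  proof cases
    case 1
    have "?z 0 = 1"
      using reflection_dominant_hd[OF a] m(1) by (simp add: reflected_period_prefix)
    then have "flip ?z <\<^sub>l ?z"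
      unfolding lex_less_def by (intro exI[of _ 0]) (simp add: seq_apply)
    then show ?thesis
      using 1 by (simp add: lex_less_imp_le)
  next
    case 2
    have "?z (m + i) = 1 - a i" if "i < m" for i
      using tail_reflected_period[OF aseq m(1)] that
      by (metis flip_apply tail_apply reflected_period_prefix)
    then show ?thesis
      using prefix_tails_dominated[of a ?z m m k, OF a z] 2 m(2)
      by (auto simp: reflected_period_prefix good_length_def lex_less_imp_le)
  next
    case 3
    have "tail k ?z = tail (k - m) (tail m ?z)"
      using 3 by simp
    also have "\<dots> = flip (tail (k - m) ?z)"
      using tail_reflected_period[OF aseq m(1)] by simp
    finally show ?thesis
      using less[of "k - m"] 3 m(1) z by simp
  qed
qed

text \<open>If \<open>w\<close> were at most the periodic sequence, dropping the common block would
  give \<open>tail m w \<le>\<^sub>l flip w\<close>, against the third assumption reflected.\<close>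

lemma reflected_period_less:
  assumes w: "w \<in> seqs {0,1}" "\<And>i. i < m \<Longrightarrow> w i = a i" "flip (tail m w) <\<^sub>l w"
  shows "reflected_period a m <\<^sub>l w" (is "?z <\<^sub>l w")
proof (rule ccontr)
  assume "\<not> ?z <\<^sub>l w"
  then have le: "w \<le>\<^sub>l ?z"
    by (simp add: not_lex_less)
  have z: "?z \<in> seqs {0,1}"
    using aseq by auto
  have "tail m w \<le>\<^sub>l tail m ?z"
    using le w(2) by (subst lex_le_tail_iff) (auto simp: reflected_period_prefix)
  also have "tail m ?z = flip ?z"
    using aseq m(1) by (rule tail_reflected_period)
  also have "flip ?z \<le>\<^sub>l flip w"
    using w(1) z le by (rule lex_le_flip)
  finally show False
    using w lex_less_flip_swap[of "tail m w" w] not_lex_less by blast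
qed

end

text \<open>For periodic \<open>a\<close> finitely many tails occur, so a fixed window suffices to compare their
  reflections with \<open>a\<close>.\<close>

lemma periodic_window:
  assumes a: "reflection_dominant a" and p: "0 < p" "tail p a = a"
  obtains L where "\<And>j. 0 < j \<Longrightarrow> lex_upto L (flip (tail j a)) a"
proof -
  have "\<exists>L. lex_upto L (flip (tail (Suc j) a)) a" for j
    using a unfolding reflection_dominant_def lex_less_iff_upto by blast
  then obtain L where L: "lex_upto (L j) (flip (tail (Suc j) a)) a" for j
    by metis
  have period: "tail (q * p + r) a = tail r a" for q r
  proof (induction q)
    case (Suc q)
    have "tail (Suc q * p + r) a = tail (q * p + r) (tail p a)"
      by (simp add: algebra_simps)
    with Suc show ?case by (simp add: p(2))
  qed simp
  have "lex_upto (\<Sum>i<p. L i) (flip (tail j a)) a" if "0 < j" for j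
  proof -
    define r where "r = (j - 1) mod p"
    have "r < p" using p(1) by (simp add: r_def)
    have "j = (j - 1) div p * p + Suc r"
      using that by (simp add: r_def)
    then have "tail j a = tail (Suc r) a"
      using period by metis
    moreover have "L r \<le> (\<Sum>i<p. L i)"
      using \<open>r < p\<close> by (intro member_le_sum) auto
    ultimately show ?thesis
      using lex_upto_mono[OF L[of r]] by simp
  qed
  then show thesis by (rule that)
qed

text \<open>An aperiodic \<open>a\<close> is strictly dominant itself. Otherwise a long good prefix
  is continued by a reflected periodic sequence \<open>?z\<close> with
  \<open>?z \<le>\<^sub>l\<close> all comparisons replaced by one: every later tail and its
  reflection are at most \<open>?z\<close>, which is smaller than \<open>x\<close>.\<close>

lemma strictly_dominant_approximation:
  assumes a: "reflection_dominant a"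
  obtains x where "strictly_dominant x" "\<And>i. i < N \<Longrightarrow> x i = a i"
proof (cases "\<exists>p>0. tail p a = a")
  case False
  then have "tail (Suc n) a <\<^sub>l a" for n
    using a unfolding reflection_dominant_def lex_le_def by blast
  then have "strictly_dominant a"
    using a by (simp add: strictly_dominant_def reflection_dominant_def)
  then show thesis using that by blast
next
  case True
  note aseq = a[unfolded reflection_dominant_def, THEN conjunct1]
  from True obtain p where p: "0 < p" "tail p a = a" by blast
  obtain L where L: "\<And>j. 0 < j \<Longrightarrow> lex_upto L (flip (tail j a)) a"
    using periodic_window[OF a p] by blast
  obtain m where m: "L \<le> m" "0 < m" "good_length a m"
    using good_length_unbounded[OF a] by blast
  \<comment> \<open>\<open>N\<close> digits must agree with \<open>a\<close>; \<open>m < M\<close>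
    lets the tail at \<open>m\<close> be treated as a tail inside the prefix, which gives
    \<open>?z <\<^sub>l x\<close>.\<close>
  obtain M where M: "Suc m + N \<le> M" "0 < M" "good_length a M"
    using good_length_unbounded[OF a] by blast
  let ?z = "reflected_period a m"
  define x where "x i = (if i < M then a i else 1 - ?z (i - M))" for i
  have z: "?z \<in> seqs {0,1}" using aseq by auto
  have x: "x \<in> seqs {0,1}"
    using aseq by (auto simp: seqs_def x_def)
  have tail_x: "tail M x = flip ?z"
    by (simp add: fun_eq_iff seq_apply x_def)
  have prefix: "tail k x <\<^sub>l x \<and> flip (tail k x) <\<^sub>l x" if "0 < k" "k < M" for k
  proof -
    have "lex_upto (min m (M - j)) (flip (tail j a)) a" if "0 < j" "j < M" for j
      using lex_upto_mono[OF L[OF that(1)] m(1)] M(3) that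
      by (auto simp: good_length_def min_def)
    moreover have "x (M + i) = 1 - a i" if "i < m" for i
      using that by (simp add: x_def reflected_period_prefix)
    moreover have "x i = a i" if "i < M" for i
      using that by (simp add: x_def)
    ultimately show ?thesis
      using prefix_tails_dominated[OF a x _ _ _ that, of m] by blast
  qed
  have less: "?z <\<^sub>l x"
    using prefix[of m] m M(1) x
    by (intro reflected_period_less[OF a m(2,3)]) (auto simp: x_def)
  have "tail k x <\<^sub>l x \<and> flip (tail k x) <\<^sub>l x" if "0 < k" for k
  proof (cases "k < M")
    case False
    then have "tail k x = tail (k - M) (tail M x)" by simp
    also have "\<dots> = flip (tail (k - M) ?z)" by (simp add: tail_x)
    finally have "tail k x = flip (tail (k - M) ?z)" .
    then show ?thesis
      using reflected_period_tails_le[OF a m(2,3), of "k - M"] less z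
      by (auto intro: lex_le_less_trans)
  qed (use prefix that in blast)
  then have "strictly_dominant x"
    using x by (simp add: strictly_dominant_def)
  moreover have "x i = a i" if "i < N" for i
    using that M(1) by (simp add: x_def)
  ultimately show thesis using that by blast
qed

section \<open>Bases whose quasi-greedy expansion is not reflection dominant\<close>

text \<open>Dropping a leading 1 never increases a sequence, so the condition after a digit 1 is
  inherited by the zeros that follow.\<close>

lemma reflect_prepend_1:
  assumes "x \<in> seqs {0,1}" "x n = 0" "flip (tail n x) <\<^sub>l a"
  shows "flip (tail (Suc n) x) <\<^sub>l a"
proof -
  have "tail (Suc 0) (flip (tail n x)) \<le>\<^sub>l flip (tail n x)"
    using assms by (intro lex_le_cons_1) (auto simp: seq_apply)
  then show ?thesis
    using assms(3) by (auto intro: lex_le_less_trans)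
qed

text \<open>Turns a window condition on all tails into forbidden words. \<open>P\<close> is
  evaluated at \<open>nth w\<close>, and \<open>cong\<close> removes the influence of the
  unspecified entries beyond the word.\<close>

lemma avoiding_words_eq:
  assumes F: "F = {w. set w \<subseteq> A \<and> length w = n \<and> \<not> P (nth w)}"
    and cong: "\<And>u v. (\<And>i. i < n \<Longrightarrow> u i = v i) \<Longrightarrow> P u \<Longrightarrow> P v"
  shows "avoiding A F = {x \<in> seqs A. \<forall>k. P (tail k x)}"
proof -
  have "(\<forall>w\<in>F. \<not> occurs w x) \<longleftrightarrow> (\<forall>k. P (tail k x))" if x: "x \<in> seqs A" for x
  proof (intro iffI allI ballI)
    fix k assume avoid: "\<forall>w\<in>F. \<not> occurs w x"
    let ?w = "map (tail k x) [0..<n]"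
    have "occurs ?w x"
      unfolding occurs_def by (intro exI[of _ k]) (simp add: seq_apply)
    with avoid have "?w \<notin> F" by blast
    moreover have "set ?w \<subseteq> A"
      using x by (auto simp: seqs_def seq_apply)
    ultimately have "P (nth ?w)"
      by (simp add: F)
    then show "P (tail k x)"
      by (rule cong[rotated]) simp
  next
    fix w assume tails: "\<forall>k. P (tail k x)" and w: "w \<in> F"
    show "\<not> occurs w x"
    proof
      assume "occurs w x"
      then obtain k where "\<And>i. i < n \<Longrightarrow> tail k x i = w ! i"
        using w by (auto simp: occurs_def F seq_apply)
      then have "P (nth w)"
        using cong tails by blast
      then show False using w by (simp add: F)
    qed
  qed
  then show ?thesis by (auto simp: avoiding_def)
qed

text \<open>Following \<open>a\<close> for \<open>n + 1\<close> digits would end in a 1, so the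
  reflected rest of \<open>x\<close> is below \<open>a\<close>; but the rest of \<open>x\<close> is
  below that of \<open>a\<close>, whose reflection is not below \<open>a\<close>.\<close>

lemma Utilde_prefix_less:
  assumes D: "\<And>k. (x k = 0 \<longrightarrow> tail (Suc k) x <\<^sub>l a) \<and> (x k = 1 \<longrightarrow> flip (tail (Suc k) x) <\<^sub>l a)"
    and a: "a \<in> seqs {0,1}" and x: "x \<in> seqs {0,1}"
    and n: "a n = 1" "\<not> flip (tail (Suc n) a) <\<^sub>l a" and k: "x k = 0"
  shows "lex_upto (Suc n) (tail (Suc k) x) a"
proof (rule ccontr)
  assume contr: "\<not> ?thesis"
  have less: "tail (Suc k) x <\<^sub>l a"
    using D k by blast
  then have agree: "\<forall>i<Suc n. tail (Suc k) x i = a i"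
    using contr lex_less_imp_upto by blast
  then have "x (Suc k + n) = 1"
    using n(1) by (simp add: seq_apply)
  then have flipped: "flip (tail (Suc (Suc k + n)) x) <\<^sub>l a"
    using D by blast
  have "tail (Suc n) (tail (Suc k) x) <\<^sub>l tail (Suc n) a"
    using less agree by (subst lex_less_tail_iff) auto
  then have "flip (tail (Suc n) a) <\<^sub>l flip (tail (Suc (Suc k + n)) x)"
    using a x by (intro lex_less_flip) (auto simp: add.commute add.left_commute)
  then show False
    using flipped n(2) lex_trans by blast
qed

lemma sft_Utilde:
  assumes b: "1 < b" "b < 2" and a: "quasi_greedy b a" and nd: "\<not> reflection_dominant a"
  shows "sft {0,1} (Utilde b)"
proof -
  note aseq = quasi_greedy_seqs[OF a]
  have ex: "\<exists>n. \<not> flip (tail (Suc n) a) <\<^sub>l a"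
    using nd aseq quasi_greedy_tail_le[OF b(1) a] by (auto simp: reflection_dominant_def)
  \<comment> \<open>Minimality forces \<open>a n = 1\<close>: a violation after a 0 is inherited
    from the preceding position.\<close>
  define n where "n = (LEAST n. \<not> flip (tail (Suc n) a) <\<^sub>l a)"
  have n: "\<not> flip (tail (Suc n) a) <\<^sub>l a"
    unfolding n_def using ex by (rule LeastI_ex)
  have an: "a n = 1"
  proof (cases n)
    case 0
    then show ?thesis using quasi_greedy_hd[OF b(1) a] by simp
  next
    case (Suc k)
    then have "flip (tail n a) <\<^sub>l a"
      using not_less_Least[of k "\<lambda>n. \<not> flip (tail (Suc n) a) <\<^sub>l a"] by (simp add: n_def)
    then show ?thesis
      using reflect_prepend_1[OF aseq] n seqs_cases[OF aseq, of n] by blast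
  qed
  define P where "P x \<longleftrightarrow> (x 0 = 0 \<longrightarrow> lex_upto (Suc n) (tail (Suc 0) x) a) \<and>
    (x 0 = 1 \<longrightarrow> lex_upto (Suc n) (flip (tail (Suc 0) x)) a)" for x
  define F where "F = {w. set w \<subseteq> {0,1} \<and> length w = Suc (Suc n) \<and> \<not> P (nth w)}"
  have "x \<in> Utilde b \<longleftrightarrow> (\<forall>k. P (tail k x))" if x: "x \<in> seqs {0,1}" for x
  proof
    assume "\<forall>k. P (tail k x)"
    then have "(x k = 0 \<longrightarrow> lex_upto (Suc n) (tail (Suc k) x) a) \<and>
      (x k = 1 \<longrightarrow> lex_upto (Suc n) (flip (tail (Suc k) x)) a)" for k
      by (auto simp: P_def tail_apply[of _ _ 0] dest: spec[of _ k])
    then show "x \<in> Utilde b"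
      using Utilde_iff_lex[OF b a x] lex_upto_imp_lex by blast
  next
    assume "x \<in> Utilde b"
    then have D: "(x k = 0 \<longrightarrow> tail (Suc k) x <\<^sub>l a) \<and> (x k = 1 \<longrightarrow> flip (tail (Suc k) x) <\<^sub>l a)" for k
      using Utilde_iff_lex[OF b a x] by blast
    \<comment> \<open>The conditions are symmetric under reflection, so the window bound after a
      digit 1 is the one after a 0 for \<open>flip x\<close>.\<close>
    have D': "(flip x k = 0 \<longrightarrow> tail (Suc k) (flip x) <\<^sub>l a) \<and>
        (flip x k = 1 \<longrightarrow> flip (tail (Suc k) (flip x)) <\<^sub>l a)" for k
      using D[of k] x seqs_cases[OF x, of k] by (auto simp: flip_apply[of x])
    have "lex_upto (Suc n) (tail (Suc k) x) a" if "x k = 0" for k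
      using Utilde_prefix_less[OF D aseq x an n that] .
    moreover have "lex_upto (Suc n) (flip (tail (Suc k) x)) a" if "x k = 1" for k
      using Utilde_prefix_less[OF D' aseq flip_in_seqs an n, of k] that by (simp add: flip_apply[of x k])
    ultimately show "\<forall>k. P (tail k x)"
      by (simp add: P_def tail_apply[of _ _ 0])
  qed
  then have "Utilde b = {x \<in> seqs {0,1}. \<forall>k. P (tail k x)}"
    by (auto simp: Utilde_def)
  also have "\<dots> = avoiding {0,1} F"
  proof (rule avoiding_words_eq[OF F_def, symmetric])
    fix u v :: "nat \<Rightarrow> nat"
    assume agree: "\<And>i. i < Suc (Suc n) \<Longrightarrow> u i = v i" and "P u"
    show "P v"
      unfolding P_def
    proof (intro conjI impI)
      assume "v 0 = 0"
      then have "lex_upto (Suc n) (tail (Suc 0) u) a"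
        using \<open>P u\<close> agree[of 0] by (simp add: P_def)
      then show "lex_upto (Suc n) (tail (Suc 0) v) a"
        by (rule lex_upto_cong) (auto simp: seq_apply agree)
    next
      assume "v 0 = 1"
      then have "lex_upto (Suc n) (flip (tail (Suc 0) u)) a"
        using \<open>P u\<close> agree[of 0] by (simp add: P_def)
      then show "lex_upto (Suc n) (flip (tail (Suc 0) v)) a"
        by (rule lex_upto_cong) (auto simp: seq_apply agree)
    qed
  qed
  finally have "Utilde b = avoiding {0,1} F" .
  moreover have "finite F"
    unfolding F_def by (rule finite_subset[OF _ finite_lists_length_eq[of "{0,1}" "Suc (Suc n)"]]) auto
  ultimately show ?thesis
    unfolding sft_def by blast
qed

section \<open>Topology of the sequence space\<close>

lemma seq_topology_eq_euclidean: "seq_topology = euclidean"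
proof -
  have "discrete_topology UNIV = (euclidean :: nat topology)"
    by (simp add: topology_eq open_discrete flip: open_openin)
  then show ?thesis
    by (simp add: seq_topology_def euclidean_product_topology)
qed

lemma tendsto_seq_iff:
  fixes f :: "'a \<Rightarrow> nat \<Rightarrow> nat"
  shows "(f \<longlongrightarrow> x) F \<longleftrightarrow> (\<forall>n. \<forall>\<^sub>F k in F. f k n = x n)"
proof -
  have "(f \<longlongrightarrow> x) F \<longleftrightarrow> limitin (product_topology (\<lambda>_. euclidean) UNIV) f x F"
    by (simp add: euclidean_product_topology)
  also have "\<dots> \<longleftrightarrow> (\<forall>n. \<forall>\<^sub>F k in F. f k n = x n)"
    by (simp add: limitin_componentwise tendsto_discrete)
  finally show ?thesis .
qed

lemma eventually_prefix_eq:
  fixes f :: "'a \<Rightarrow> nat \<Rightarrow> nat"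
  assumes "(f \<longlongrightarrow> x) F"
  shows "\<forall>\<^sub>F k in F. \<forall>i<n. f k i = x i"
  using assms unfolding tendsto_seq_iff by (simp add: eventually_ball_finite flip: lessThan_iff Ball_def)

lemma open_digit: "open {x :: nat \<Rightarrow> nat. x n \<in> B}"
proof -
  have "open ((\<lambda>x :: nat \<Rightarrow> nat. x n) -` B)"
    by (intro open_vimage continuous_on_product_coordinates open_discrete)
  then show ?thesis by (simp add: vimage_def)
qed

lemma closed_seqs: "closed (seqs A)"
proof -
  have "closed (\<Inter>n. - {x :: nat \<Rightarrow> nat. x n \<in> - A})"
    by (intro closed_INT ballI closed_Compl open_digit)
  moreover have "(\<Inter>n. - {x :: nat \<Rightarrow> nat. x n \<in> - A}) = seqs A"
    by (auto simp: seqs_def)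
  ultimately show ?thesis by simp
qed

lemma compact_seqs: "finite A \<Longrightarrow> compact (seqs A)"
proof -
  assume "finite A"
  then have "compactin (product_topology (\<lambda>_. euclidean) UNIV) (PiE UNIV (\<lambda>_::nat. A))"
    by (simp add: compactin_PiE finite_imp_compact)
  moreover have "PiE UNIV (\<lambda>_. A) = seqs A"
    by (auto simp: seqs_def PiE_def)
  ultimately show ?thesis
    by (simp add: euclidean_product_topology)
qed

lemma closed_avoiding: "closed (avoiding A F)"
proof -
  have "{x. occurs w x} = (\<Union>k. \<Inter>i\<in>{..<length w}. {x. x (k + i) \<in> {w ! i}})" for w
    by (auto simp: occurs_def)
  then have "open {x. occurs w x}" for w
    by (simp only:) (intro open_UN open_INT ballI finite_lessThan open_digit)
  then have "closed (\<Inter>w\<in>F. - {x. occurs w x})"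
    by (intro closed_INT ballI) (simp add: closed_def)
  moreover have "avoiding A F = seqs A \<inter> (\<Inter>w\<in>F. - {x. occurs w x})"
    by (auto simp: avoiding_def)
  ultimately show ?thesis
    using closed_seqs by auto
qed

lemma subshift_imp_closedin:
  assumes "subshift A Y"
  shows "closedin (subtopology seq_topology (seqs A)) Y"
proof -
  obtain F where "Y = avoiding A F"
    using assms by (auto simp: subshift_def)
  then show ?thesis
    using closed_avoiding
    by (auto simp: seq_topology_eq_euclidean avoiding_def intro!: closed_subset)
qed

lemma sft_imp_sofic:
  assumes "sft {0,1} Y"
  shows "sofic {0,1} Y"
proof -
  have "{..<2::nat} = {0,1}" by auto
  with assms have "sft {..<2} Y" by simp
  then show ?thesis
    using assms unfolding sofic_def subshift_def sft_def
    by (intro conjI exI[of _ "2::nat"] exI[of _ Y] exI[of _ id]) auto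
qed

section \<open>Limits of sequences and of their values\<close>

lemma lex_le_tendsto:
  fixes f g :: "'a \<Rightarrow> nat \<Rightarrow> nat"
  assumes "(f \<longlongrightarrow> x) F" "(g \<longlongrightarrow> y) F" "\<And>k. f k \<le>\<^sub>l g k" "F \<noteq> bot"
  shows "x \<le>\<^sub>l y"
proof (rule ccontr)
  assume "\<not> x \<le>\<^sub>l y"
  \<comment> \<open>A violation is visible in finitely many digits, which \<open>f k\<close> and
    \<open>g k\<close> eventually share with their limits.\<close>
  then obtain n where n: "lex_upto n y x"
    by (auto simp: lex_less_iff_upto simp flip: not_lex_less)
  have "\<forall>\<^sub>F k in F. (\<forall>i<n. f k i = x i) \<and> (\<forall>i<n. g k i = y i)"
    using assms(1,2) by (intro eventually_conj eventually_prefix_eq)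
  then obtain k where "\<forall>i<n. f k i = x i" "\<forall>i<n. g k i = y i"
    using assms(4) eventually_happens' by blast
  then have "lex_upto n (g k) (f k)"
    using lex_upto_cong[OF n] by blast
  then show False
    using assms(3)[of k] lex_upto_imp_lex not_lex_less by blast
qed

lemma tendsto_tail:
  fixes f :: "'a \<Rightarrow> nat \<Rightarrow> nat"
  shows "(f \<longlongrightarrow> x) F \<Longrightarrow> ((\<lambda>k. tail n (f k)) \<longlongrightarrow> tail n x) F"
  by (simp add: tendsto_seq_iff tail_apply)

lemma tendsto_flip: "(f \<longlongrightarrow> x) F \<Longrightarrow> ((\<lambda>k. flip (f k)) \<longlongrightarrow> flip x) F"
  unfolding tendsto_seq_iff flip_apply by (blast intro: eventually_mono arg_cong[of _ _ "(-) (1::nat)"])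

lemma tendsto_bval:
  assumes "(g \<longlongrightarrow> b) F" "(f \<longlongrightarrow> x) F" "1 < b" "\<forall>\<^sub>F k in F. f k \<in> seqs {0,1}" "F \<noteq> bot"
  shows "((\<lambda>k. bval (g k) (f k)) \<longlongrightarrow> bval b x) F"
proof -
  \<comment> \<open>The bases eventually exceed \<open>c\<close>, so the geometric series in
    \<open>1 / c\<close> dominates and Tannery's theorem allows termwise limits.\<close>
  obtain c where c: "1 < c" "c < b"
    using assms(3) dense by blast
  define a where "a n k = real (f k n) / g k ^ Suc n" for n k
  have "\<forall>\<^sub>F k in F. c < g k \<and> f k \<in> seqs {0,1}"
    using order_tendstoD(1)[OF assms(1) c(2)] assms(4) by eventually_elim simp
  from eventually_prodI[OF eventually_True this]
  have "\<forall>\<^sub>F p in at_top \<times>\<^sub>F F. c < g (snd p) \<and> f (snd p) \<in> seqs {0,1}"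
    by simp
  then have bound: "\<forall>\<^sub>F (n, k) in at_top \<times>\<^sub>F F. norm (a n k) \<le> (1 / c) ^ n"
  proof eventually_elim
    case (elim p)
    obtain n k where p: "p = (n, k)" by (cases p)
    have "c ^ n \<le> c ^ Suc n"
      using c by (intro power_increasing) auto
    also have "\<dots> \<le> g k ^ Suc n"
      using c elim p by (intro power_mono) auto
    finally have "norm (a n k) \<le> 1 / c ^ n"
      unfolding a_def using seqs_le_1[of "f k" n] c elim p
      by (auto simp: abs_of_pos intro!: frac_le simp del: power_Suc)
    then show ?case by (simp add: p power_one_over)
  qed
  have "((\<lambda>k. a n k) \<longlongrightarrow> real (x n) / b ^ Suc n) F" for n
    unfolding a_def
  proof (intro tendsto_intros assms)
    show "((\<lambda>k. real (f k n)) \<longlongrightarrow> real (x n)) F"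
      using assms(2) unfolding tendsto_seq_iff
      by (intro tendsto_eventually) (auto elim: eventually_mono)
  qed (use assms(3) in auto)
  moreover have "summable (\<lambda>n. (1 / c) ^ n)"
    using c by (intro summable_geometric) auto
  ultimately show ?thesis
    using tannerys_theorem[OF _ bound] assms(5) by (simp add: bval_def a_def)
qed

lemma bval_strict_antimono:
  assumes "1 < b" "b < c" "x \<in> seqs {0,1}" "x n \<noteq> 0"
  shows "bval c x < bval b x"
proof -
  have "0 < (\<Sum>n. real (x n) / b ^ Suc n - real (x n) / c ^ Suc n)"
  proof (rule suminf_pos2)
    show "summable (\<lambda>n. real (x n) / b ^ Suc n - real (x n) / c ^ Suc n)"
      using assms by (intro summable_diff summable_bval) auto
    have le: "c ^ Suc i > b ^ Suc i" for i
      using assms by (intro power_strict_mono) auto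
    have pos: "b ^ Suc i > 0" for i using assms by simp
    show "0 \<le> real (x i) / b ^ Suc i - real (x i) / c ^ Suc i" for i
      using le[of i] pos[of i] by (simp add: frac_le less_imp_le del: power_Suc)
    show "0 < real (x n) / b ^ Suc n - real (x n) / c ^ Suc n"
      using le[of n] pos[of n] assms(4) by (simp add: frac_less2 del: power_Suc)
  qed
  also have "\<dots> = bval b x - bval c x"
    unfolding bval_def using assms by (intro suminf_diff[symmetric] summable_bval) auto
  finally show ?thesis by simp
qed

section \<open>The closure of \<open>Ucal\<close>\<close>

lemma strictly_dominant_imp_Ucal:
  assumes b: "1 < b" "b < 2" and x: "strictly_dominant x" "bval b x = 1"
  shows "b \<in> Ucal"
proof -
  have xseq: "x \<in> seqs {0,1}" and tails: "\<And>n. tail (Suc n) x <\<^sub>l x" "\<And>n. flip (tail (Suc n) x) <\<^sub>l x"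
    using x(1) by (auto simp: strictly_dominant_def)
  have "quasi_greedy b x"
  proof (rule quasi_greedyI[OF b(1) xseq x(2)])
    show "tail n x \<le>\<^sub>l x" for n
      using tails(1) by (cases n) (auto intro: lex_less_imp_le)
    show "\<exists>i. x (n + i) \<noteq> 0" for n
    proof (rule ccontr)
      assume zero: "\<nexists>i. x (n + i) \<noteq> 0"
      then have "x (Suc (n + i)) = 0" for i
        by (metis add_Suc_right)
      then have "flip (tail (Suc n) x) i = 1" for i
        by (simp add: seq_apply)
      then show False
        using tails(2)[of n] seqs_le_1[OF xseq] unfolding lex_less_def by (metis not_less)
    qed
  qed
  then have "x \<in> Utilde b"
    using Utilde_iff_lex[OF b _ xseq] tails by blast
  then show ?thesis
    using b x(2) by (auto simp: Ucal_def Utilde_def)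
qed

text \<open>A strictly dominant sequence close to \<open>a\<close> has value above 1 at
  \<open>b1 < b\<close> and below 1 at \<open>b2 > b\<close>, hence value 1 at an intermediate base,
  which lies in \<open>Ucal\<close>.\<close>

lemma reflection_dominant_imp_closure_Ucal:
  assumes b: "1 < b" "b < 2" and a: "reflection_dominant a" "bval b a = 1"
  shows "b \<in> closure Ucal"
  unfolding closure_approachable
proof (intro allI impI)
  fix e :: real assume "0 < e"
  have aseq: "a \<in> seqs {0,1}"
    using a(1) by (simp add: reflection_dominant_def)
  obtain b1 where b1: "max 1 (b - e) < b1" "b1 < b"
    using dense[of "max 1 (b - e)" b] b \<open>0 < e\<close> by auto
  obtain b2 where b2: "b < b2" "b2 < min 2 (b + e)"
    using dense[of b "min 2 (b + e)"] b \<open>0 < e\<close> by auto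
  have "\<exists>x. strictly_dominant x \<and> (\<forall>i<N. x i = a i)" for N
    using strictly_dominant_approximation[OF a(1), of N] by metis
  then obtain f where f: "strictly_dominant (f N)" "\<forall>i<N. f N i = a i" for N
    by metis
  have fseq: "f N \<in> seqs {0,1}" for N
    using f(1) by (simp add: strictly_dominant_def)
  have "f \<longlonglongrightarrow> a"
    unfolding tendsto_seq_iff
  proof
    show "\<forall>\<^sub>F N in sequentially. f N n = a n" for n
      using eventually_gt_at_top[of n] by eventually_elim (use f(2) in blast)
  qed
  then have lim: "(\<lambda>N. bval c (f N)) \<longlonglongrightarrow> bval c a" if "1 < c" for c
    using that fseq by (intro tendsto_bval) auto
  have "a 0 \<noteq> 0"
    using reflection_dominant_hd[OF a(1)] by simp
  then have "1 < bval b1 a" "bval b2 a < 1"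
    using bval_strict_antimono[of b1 b a 0] bval_strict_antimono[of b b2 a 0] b1 b2 b a(2) aseq by auto
  then have "\<forall>\<^sub>F N in sequentially. 1 < bval b1 (f N) \<and> bval b2 (f N) < 1"
    using b b1 b2 by (intro eventually_conj order_tendstoD[OF lim]) auto
  then obtain N where N: "1 < bval b1 (f N)" "bval b2 (f N) < 1"
    using eventually_happens'[OF sequentially_bot] by blast
  have "continuous_on {b1..b2} (\<lambda>c. bval c (f N))"
    unfolding continuous_on_def
  proof
    fix c assume c: "c \<in> {b1..b2}"
    show "((\<lambda>c. bval c (f N)) \<longlongrightarrow> bval c (f N)) (at c within {b1..b2})"
    proof (cases "at c within {b1..b2} = bot")
      case False
      then show ?thesis
        using c b1 fseq by (intro tendsto_bval) (auto intro: tendsto_ident_at)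
    qed simp
  qed
  then obtain c where c: "b1 \<le> c" "c \<le> b2" "bval c (f N) = 1"
    using IVT2'[of "\<lambda>c. bval c (f N)" b2 1 b1] N b1 b2 by force
  then have "c \<in> Ucal"
    using b1 b2 f(1) by (intro strictly_dominant_imp_Ucal[of c "f N"]) auto
  moreover have "dist c b < e"
    using c b1 b2 by (simp add: dist_real_def abs_less_iff)
  ultimately show "\<exists>c\<in>Ucal. dist c b < e" by blast
qed

text \<open>The unique expansion is the quasi-greedy one. Membership in \<open>Utilde\<close> gives
  the reflected inequality after each 1; since the first digit is 1, induction carries it across
  zeros.\<close>

lemma Ucal_expansion:
  assumes "b \<in> Ucal"
  obtains x where "quasi_greedy b x" "reflection_dominant x"
proof -
  have b: "1 < b" "b < 2" and ex1: "\<exists>!x. x \<in> seqs {0,1} \<and> bval b x = 1"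
    using assms by (auto simp: Ucal_def)
  obtain x where x: "quasi_greedy b x"
    using quasi_greedy_exists[OF b] by blast
  note xseq = quasi_greedy_seqs[OF x]
  have U: "x \<in> Utilde b"
    unfolding Utilde_def using ex1 x by (auto simp: quasi_greedy_def)
  have "flip (tail (Suc n) x) <\<^sub>l x" for n
  proof (induction n)
    case 0
    then show ?case
      using Utilde_iff_lex[OF b x xseq] U quasi_greedy_hd[OF b(1) x] by blast
  next
    case (Suc n)
    then show ?case
      using Utilde_iff_lex[OF b x xseq] U reflect_prepend_1[OF xseq] seqs_cases[OF xseq, of "Suc n"]
      by blast
  qed
  then have "reflection_dominant x"
    using xseq quasi_greedy_tail_le[OF b(1) x] by (simp add: reflection_dominant_def)
  with that x show thesis by blast
qed

text \<open>At the first difference \<open>x\<close> exceeds \<open>a\<close>, hence exceeds its own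
  digit one period earlier, so \<open>tail p x\<close> would be larger than
  \<open>x\<close>.\<close>

lemma periodic_prefix_not_less:
  assumes "tail p a = a" and "\<And>i. i < p \<Longrightarrow> x i = a i" and "tail p x \<le>\<^sub>l x" and "0 < p"
  shows "\<not> a <\<^sub>l x"
proof
  assume "a <\<^sub>l x"
  then obtain j where j: "\<forall>i<j. a i = x i" "a j < x j"
    by (auto simp: lex_less_def)
  have pj: "p \<le> j"
    using assms(2) j(2) by (metis leI less_irrefl)
  have period: "a (p + i) = a i" for i
    using assms(1) by (metis tail_apply)
  have "x <\<^sub>l tail p x"
    unfolding lex_less_def
  proof (intro exI conjI allI impI)
    fix i assume "i < j - p"
    then show "x i = tail p x i"
      using j(1)[rule_format, of i] j(1)[rule_format, of "p + i"] period[of i] by (simp add: seq_apply)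
  next
    show "x (j - p) < tail p x (j - p)"
      using j pj assms(4) period[of "j - p"] j(1)[rule_format, of "j - p"] by (simp add: seq_apply)
  qed
  with assms(3) show False by (meson not_lex_less)
qed

text \<open>The unique expansions of 1 for bases converging to \<open>b\<close> accumulate at a sequence \<open>x\<close> that
  satisfies all inequalities weakly. If \<open>flip (tail n x) = x\<close>, then \<open>x\<close> is periodic, and an expansion
  close to \<open>x\<close> can lie neither below nor above \<open>x\<close>.\<close>

lemma closure_Ucal_imp_reflection_dominant:
  assumes b: "1 < b" "b < 2" and cl: "b \<in> closure Ucal"
  obtains a where "quasi_greedy b a" "reflection_dominant a"
proof -
  obtain c where c: "\<And>k. c k \<in> Ucal" "c \<longlonglongrightarrow> b"
    using cl unfolding closure_sequential by blast
  have "\<exists>x. quasi_greedy (c k) x \<and> reflection_dominant x" for k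
    using Ucal_expansion[OF c(1)] by metis
  then obtain f where f: "quasi_greedy (c k) (f k)" "reflection_dominant (f k)" for k
    by metis
  have "seq_compact (seqs {0,1})"
    by (intro compact_imp_seq_compact compact_seqs) simp
  then obtain r x where x: "x \<in> seqs {0,1}" and r: "strict_mono r" "(f \<circ> r) \<longlonglongrightarrow> x"
    using quasi_greedy_seqs[OF f(1)] unfolding seq_compact_def by metis
  define d y where "d = c \<circ> r" and "y = f \<circ> r"
  have d: "d \<longlonglongrightarrow> b" and y: "y \<longlonglongrightarrow> x"
      "\<And>k. quasi_greedy (d k) (y k)" "\<And>k. reflection_dominant (y k)"
    using LIMSEQ_subseq_LIMSEQ[OF c(2) r(1)] r(2) f by (auto simp: d_def y_def)
  have yseq: "y k \<in> seqs {0,1}" for k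
    using y(2) by (rule quasi_greedy_seqs)
  have yval: "bval (d k) (y k) = 1" for k
    using y(2) by (simp add: quasi_greedy_def)
  have "(\<lambda>k. bval (d k) (y k)) \<longlonglongrightarrow> bval b x"
    using d y yseq b by (intro tendsto_bval) auto
  then have val: "bval b x = 1"
    unfolding yval by (simp add: LIMSEQ_const_iff)
  have tail_le: "tail n x \<le>\<^sub>l x" for n
    using tendsto_tail[OF y(1)] y(1)
    by (rule lex_le_tendsto) (use y(3) in \<open>auto simp: reflection_dominant_def\<close>)
  have flip_le: "flip (tail (Suc n) x) \<le>\<^sub>l x" for n
    using tendsto_flip[OF tendsto_tail[OF y(1)]] y(1)
    by (rule lex_le_tendsto) (use y(3) in \<open>auto simp: reflection_dominant_def lex_less_imp_le\<close>)
  have "quasi_greedy b x"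
  proof (rule quasi_greedyI[OF b(1) x val tail_le])
    show "\<exists>i. x (n + i) \<noteq> 0" for n
    proof (rule ccontr)
      assume "\<nexists>i. x (n + i) \<noteq> 0"
      then have zero: "x (n + i) = 0" for i by blast
      have one: "flip (tail (Suc n) x) i = 1" for i
        using zero[of "Suc i"] by (simp add: seq_apply)
      \<comment> \<open>The reflection of a zero tail is constantly 1 and at most \<open>x\<close>,
        so \<open>x\<close> would be constantly 1.\<close>
      have "flip (tail (Suc n) x) = x"
      proof (rule ccontr)
        assume "flip (tail (Suc n) x) \<noteq> x"
        then have "flip (tail (Suc n) x) <\<^sub>l x"
          using flip_le[of n] by (simp add: lex_le_def)
        then show False
          using one seqs_le_1[OF x] unfolding lex_less_def by (metis not_less)
      qed
      then show False
        using one[of n] zero[of 0] by simp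
    qed
  qed
  moreover have "flip (tail (Suc n) x) <\<^sub>l x" for n
  proof (rule ccontr)
    let ?n = "Suc n"
    assume "\<not> flip (tail ?n x) <\<^sub>l x"
    then have eq: "flip (tail ?n x) = x"
      using flip_le[of n] by (simp add: lex_le_def)
    then have eq': "tail ?n x = flip x"
      using flip_flip[OF tail_in_seqs[OF x, of ?n]] by simp
    have "tail ?n (tail ?n x) = x"
      using x by (simp add: eq' eq del: tail_tail)
    then have period: "tail (?n + ?n) x = x"
      by (simp only: tail_tail)
    \<comment> \<open>Agreement over both halves of the period, as needed to compare
      \<open>y k\<close> with \<open>x\<close>.\<close>
    obtain k where k: "\<forall>i<?n + ?n. y k i = x i"
      using eventually_happens'[OF sequentially_bot eventually_prefix_eq[OF y(1)]] by blast
    have flip_y: "flip (tail ?n (y k)) <\<^sub>l y k" and tail_y: "\<And>i. tail i (y k) \<le>\<^sub>l y k"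
      using y(3)[of k] by (auto simp: reflection_dominant_def)
    have "\<not> x <\<^sub>l y k"
      using periodic_prefix_not_less[OF period] k tail_y by blast
    then consider "y k = x" | "y k <\<^sub>l x"
      using lex_total by blast
    then show False
    proof cases
      case 1
      then show False using flip_y eq by simp
    next
      case 2
      \<comment> \<open>From \<open>y k <\<^sub>l x\<close>, passing through \<open>flip x\<close>,
        the tail drops below \<open>flip (y k)\<close>, whereas dominance of \<open>y k\<close> puts
        it above.\<close>
      then have "tail ?n (y k) <\<^sub>l tail ?n x"
        using k by (subst lex_less_tail_iff) auto
      also have "tail ?n x = flip x" by (rule eq')
      also have "flip x <\<^sub>l flip (y k)"
        using lex_less_flip[OF yseq x 2] .
      finally have "tail ?n (y k) <\<^sub>l flip (y k)" .
      moreover have "flip (y k) <\<^sub>l tail ?n (y k)"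
        using flip_y lex_less_flip_swap[OF tail_in_seqs[OF yseq] yseq] by blast
      ultimately show False
        using lex_trans lex_irrefl by blast
    qed
  qed
  ultimately show thesis
    using that x tail_le by (simp add: reflection_dominant_def)
qed

text \<open>The leading 0 makes \<open>z N <\<^sub>l a\<close> a membership condition; in the limit
  it degenerates to \<open>a <\<^sub>l a\<close>.\<close>

lemma reflection_dominant_imp_not_closed:
  assumes b: "1 < b" "b < 2" and a: "quasi_greedy b a" "reflection_dominant a"
  shows "\<not> closed (Utilde b)"
proof
  assume "closed (Utilde b)"
  note aseq = quasi_greedy_seqs[OF a(1)]
  have "\<exists>m. N \<le> m \<and> 0 < m \<and> good_length a m" for N
    using good_length_unbounded[OF a(2), of N] by metis
  then obtain m where m: "N \<le> m N" "0 < m N" "good_length a (m N)" for N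
    by metis
  define z where "z N = reflected_period a (m N)" for N
  have zseq: "z N \<in> seqs {0,1}" for N
    using aseq by (auto simp: z_def)
  have z_less: "z N <\<^sub>l a" for N
  proof -
    obtain k where "m N = Suc k"
      using m(2)[of N] gr0_implies_Suc by blast
    then have "flip (tail (m N) a) <\<^sub>l a"
      using a(2) by (simp add: reflection_dominant_def)
    then show ?thesis
      unfolding z_def by (intro reflected_period_less[OF a(2) m(2,3) aseq refl])
  qed
  have z_tails: "tail k (z N) <\<^sub>l a" "flip (tail k (z N)) <\<^sub>l a" for k N
    using reflected_period_tails_le[OF a(2) m(2,3), of k N] z_less[of N] lex_le_less_trans
    unfolding z_def by blast+
  have tail_cons: "tail (Suc n) (case_nat 0 u) = tail n u" for n and u :: "nat \<Rightarrow> nat"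
    by (simp add: fun_eq_iff seq_apply)
  have cons: "case_nat 0 u \<in> seqs {0,1}" if "u \<in> seqs {0,1}" for u
    using that by (auto simp: seqs_def split: nat.splits)
  have "case_nat 0 (z N) \<in> Utilde b" for N
    unfolding Utilde_iff_lex[OF b a(1) cons[OF zseq]] tail_cons by (simp add: z_tails)
  moreover have "(\<lambda>N. case_nat 0 (z N)) \<longlonglongrightarrow> case_nat 0 a"
    unfolding tendsto_seq_iff
  proof
    fix n
    show "\<forall>\<^sub>F N in sequentially. case_nat 0 (z N) n = case_nat 0 a n"
    proof (cases n)
      case (Suc i)
      have "z N i = a i" if "i < N" for N
        using that m(1)[of N] by (simp add: z_def reflected_period_prefix)
      then show ?thesis
        unfolding Suc nat.case by (rule eventually_mono[OF eventually_gt_at_top[of i]])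
    qed simp
  qed
  ultimately have "case_nat 0 a \<in> Utilde b"
    by (rule closed_sequentially[OF \<open>closed (Utilde b)\<close>])
  then have "tail (Suc 0) (case_nat 0 a) <\<^sub>l a"
    using Utilde_iff_lex[OF b a(1) cons[OF aseq]] by (metis nat.case(1))
  then show False
    by (simp add: tail_cons)
qed

section \<open>The equivalences\<close>

theorem theorem4p7:
  fixes \<beta> :: real
  assumes "1 < \<beta>" and "\<beta> < 2"
  shows "(\<beta> \<in> {1<..<2} - closure Ucal \<longleftrightarrow> subshift {0,1} (Utilde \<beta>))
       \<and> (\<beta> \<in> {1<..<2} - closure Ucal \<longleftrightarrow> sft {0,1} (Utilde \<beta>))
       \<and> (\<beta> \<in> {1<..<2} - closure Ucal \<longleftrightarrow>
            closedin (subtopology seq_topology (seqs {0,1})) (Utilde \<beta>))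
       \<and> (\<beta> \<in> {1<..<2} - closure Ucal \<longleftrightarrow> sofic {0,1} (Utilde \<beta>))
       \<and> \<not> strictly_sofic {0,1} (Utilde \<beta>)"
proof -
  let ?Y = "Utilde \<beta>"
  have closure_imp: "\<not> closed ?Y" if "\<beta> \<in> closure Ucal"
    using closure_Ucal_imp_reflection_dominant[OF assms that]
      reflection_dominant_imp_not_closed[OF assms] by metis
  have imp_sft: "sft {0,1} ?Y" if "\<beta> \<notin> closure Ucal"
  proof -
    obtain a where a: "quasi_greedy \<beta> a"
      using quasi_greedy_exists[OF assms] by blast
    then have "\<not> reflection_dominant a"
      using reflection_dominant_imp_closure_Ucal[OF assms, of a] that
      by (auto simp: quasi_greedy_def)
    with assms a show ?thesis by (rule sft_Utilde)
  qed
  have closedin_imp: "closed ?Y" if "closedin (subtopology seq_topology (seqs {0,1})) ?Y"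
    using that closedin_closed_trans[of "seqs {0,1}" ?Y] closed_seqs
    by (simp add: seq_topology_eq_euclidean)
  \<comment> \<open>The cycle runs from the complement of the closure through finite type, sofic,
    subshift and closed back to the complement.\<close>
  have "sft {0,1} ?Y \<Longrightarrow> sofic {0,1} ?Y" "sofic {0,1} ?Y \<Longrightarrow> subshift {0,1} ?Y"
    using sft_imp_sofic by (auto simp: sofic_def)
  moreover have "subshift {0,1} ?Y \<Longrightarrow> closedin (subtopology seq_topology (seqs {0,1})) ?Y"
    by (rule subshift_imp_closedin)
  moreover have "\<beta> \<in> {1<..<2} - closure Ucal \<longleftrightarrow> \<beta> \<notin> closure Ucal"
    using assms by simp
  ultimately show ?thesis
    unfolding strictly_sofic_def using closure_imp imp_sft closedin_imp by blast
qed

end
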